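(* Fix $\varepsilon>0$. For each of the three shuffles of a deck of $n$ cards below there is a sequence $o(1)\to 0$ as $n\to\infty$ (which may depend on $\varepsilon$) such that, starting from a fixed ordering of the deck, the distribution of the state of the deck after the indicated number of shuffles (rounded down to an integer) has total variation distance at least $1-\varepsilon$ from the uniform distribution on the $n!$ orderings, for all sufficiently large $n$: (i) after $\frac{1-o(1)}{8\pi^2}\, n^3\log n$ shuffles of the Rudvalis shuffle; (ii) after $\frac{1-o(1)}{2\pi^2}\, n^3\log n$ shuffles of the shift-or-swap shuffle; (iii) after $\frac{1-o(1)}{\pi^2}\, n^3\log n$ shuffles of the symmetrized Rudvalis shuffle.
   Context: Each shuffle is a Markov chain on the orderings of a deck of $n$ cards, with independent moves at successive steps. Rudvalis shuffle: at each step, with probability $1/2$ move the top card to the bottom of the deck, and with probability $1/2$ move the top card to the second position from the bottom. Shift-or-swap shuffle: at each step, with probability $1/2$ move the top card to the bottom of the deck, and with probability $1/2$ exchange the top two cards. Symmetrized Rudvalis shuffle: at each step do one of the following four moves, each with probability $1/4$: move the top card to the bottom, move the bottom card to the top, exchange the top two cards, or do nothing. The total variation distance between probability distributions $\nu,\mu$ on a finite set is $\|\nu-\mu\|_{\mathrm{TV}}=\max_A|\nu(A)-\mu(A)|=\frac12\sum_y|\nu(y)-\mu(y)|$. Here $\log$ is the natural logarithm. *)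

theory Defs
  imports "HOL-Probability.Probability" "HOL-Combinatorics.Multiset_Permutations"
begin

text \<open>
  A deck is the list of its cards from top to bottom.  The orderings of a deck of \<open>n\<close> cards
  are the elements of \<^term>\<open>permutations_of_set {..<n}\<close>.  Moving the top card to the
  bottom is \<^term>\<open>rotate1\<close>.
\<close>

fun top_to_second_bottom :: "'a list \<Rightarrow> 'a list" where
  "top_to_second_bottom (x # y # zs) = butlast (y # zs) @ [x, last (y # zs)]"
| "top_to_second_bottom xs = xs"

fun bottom_to_top :: "'a list \<Rightarrow> 'a list" where
  "bottom_to_top [] = []"
| "bottom_to_top (x # xs) = last (x # xs) # butlast (x # xs)"

fun swap_top :: "'a list \<Rightarrow> 'a list" where
  "swap_top (x # y # zs) = y # x # zs"
| "swap_top xs = xs"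

text \<open>
  Multisets of outcomes are used because, for small decks, different moves may lead to the
  same ordering.
\<close>

definition rudvalis :: "'a list \<Rightarrow> 'a list pmf" where
  "rudvalis xs = pmf_of_multiset {# rotate1 xs, top_to_second_bottom xs #}"

definition shift_or_swap :: "'a list \<Rightarrow> 'a list pmf" where
  "shift_or_swap xs = pmf_of_multiset {# rotate1 xs, swap_top xs #}"

definition symmetrized_rudvalis :: "'a list \<Rightarrow> 'a list pmf" where
  "symmetrized_rudvalis xs =
     pmf_of_multiset {# rotate1 xs, bottom_to_top xs, swap_top xs, xs #}"

definition law_after :: "('s \<Rightarrow> 's pmf) \<Rightarrow> 's \<Rightarrow> nat \<Rightarrow> 's pmf" where
  "law_after K s t = ((\<lambda>p. bind_pmf p K) ^^ t) (return_pmf s)"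

definition uniform_deck :: "nat \<Rightarrow> nat list pmf" where
  "uniform_deck n = pmf_of_set (permutations_of_set {..<n})"

text \<open>The supremum is a maximum when both distributions have finite support.\<close>

definition tv_dist :: "'s pmf \<Rightarrow> 's pmf \<Rightarrow> real" where
  "tv_dist \<nu> \<mu> = (SUP A. \<bar>measure_pmf.prob \<nu> A - measure_pmf.prob \<mu> A\<bar>)"

end

theory Submission
  imports Defs "HOL-Complex_Analysis.Conformal_Mappings" "HOL-Real_Asymp.Real_Asymp"
begin

text \<open>
  Seen relative to the overall rotation of the deck, a single card is displaced by a bounded
  random amount each time it comes to the end of the deck at which the shuffle acts, which
  happens on average once in the order of \<open>n\<close> steps.  Its relative position modulo \<open>n\<close> therefore performs a diffusion
  that needs of the order of \<open>n\<^sup>3\<close> steps to spread, and the slowest Fourier mode of that diffusion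
  decays like \<open>exp (- g t / n\<^sup>3)\<close>, with \<open>g = 4 \<pi>\<^sup>2\<close> for the Rudvalis shuffle, \<open>g = \<pi>\<^sup>2\<close> for
  shift-or-swap and \<open>g = \<pi>\<^sup>2 / 2\<close> for the symmetrized shuffle.  Let \<open>\<Phi>\<close> be the sum over all cards of
  this mode, weighted with the conjugate of the value at the starting position of the card.  At
  the start \<open>\<Phi>\<close> has order \<open>n\<close>, in a uniformly random deck it has order \<open>sqrt n\<close>.  The two can be told
  apart as long as \<open>n exp (- g t / n\<^sup>3)\<close> is much larger than \<open>sqrt n\<close>, that is, up to
  \<open>t = (1 - o(1)) n\<^sup>3 ln n / (2 g)\<close>.

  This is Wilson's second moment method, and the locale \<open>twisted_eigenfunction\<close> carries it out.  For
  shift-or-swap and for the symmetrized shuffle the amount of rotation is itself random, with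
  fluctuations that would smear out \<open>\<Phi>\<close> long before time \<open>n\<^sup>3\<close>.  The remedy is to give each move \<open>j\<close>
  a phase \<open>\<tau> j\<close> of modulus 1 and to demand that the average of \<open>\<tau> j * \<Phi> (act j s)\<close> over the moves
  is \<open>\<kappa> * \<Phi> s\<close>.  If \<open>u\<close> is the product of the phases so far, then \<open>u * \<Phi>\<close> has mean \<open>\<kappa> ^ t * \<Phi> start\<close>,
  and since \<open>norm (u * \<Phi>) = norm \<Phi>\<close>, an event about \<open>norm \<Phi>\<close> does not involve the phase.  Beyond
  the phase and the factor \<open>\<kappa>\<close>, a step changes \<open>\<Phi>\<close> by at most \<open>O(1/n)\<close>, so the variance stays below
  \<open>O(1/n\<^sup>2) / (1 - (norm \<kappa>)\<^sup>2) = O(n)\<close>, both along the walk and under the uniform distribution.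

  What remains is to find, for each shuffle, a mode \<open>f\<close> of one card with eigenvalue \<open>\<kappa>\<close> such that
  \<open>n\<^sup>3 (1 - (norm \<kappa>)\<^sup>2)\<close> tends to \<open>2 g\<close> (\<open>slow_mode\<close>, \<open>mixing_lower_bound\<close>).  Away from one end
  of the deck \<open>f\<close> is explicit, and the conditions at that end amount to one equation.  For the
  first two shuffles it is a complex equation for \<open>\<kappa>\<close> that, on the scale \<open>1 + z / n\<^sup>3\<close>
  (times a root of unity for the Rudvalis shuffle), is asymptotically linear in \<open>z\<close> and is solved by \<open>zero_of_nearly_linear\<close>.  For the third shuffle
  the chain is reversible and \<open>\<kappa>\<close> real, and the equation is a real trigonometric one, solved by the
  intermediate value theorem (\<open>symmetrized_rudvalis_frequency\<close>).
\<close>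

section \<open>Wilson's second moment bound with phases\<close>

lemma tv_dist_ge_prob_diff:
  "\<bar>measure_pmf.prob \<nu> A - measure_pmf.prob \<mu> A\<bar> \<le> tv_dist \<nu> \<mu>"
  unfolding tv_dist_def
proof (rule cSUP_upper)
  have "\<bar>measure_pmf.prob \<nu> B - measure_pmf.prob \<mu> B\<bar> \<le> 1" for B
    using measure_pmf.prob_le_1[of \<nu> B] measure_pmf.prob_le_1[of \<mu> B]
      measure_nonneg[of "measure_pmf \<nu>" B] measure_nonneg[of "measure_pmf \<mu>" B]
    by linarith
  then show "bdd_above (range (\<lambda>A. \<bar>measure_pmf.prob \<nu> A - measure_pmf.prob \<mu> A\<bar>))"
    by (intro bdd_aboveI[of _ 1]) auto
qed simp

lemma prob_norm_ge_le_second_moment: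
  fixes Z :: "'a \<Rightarrow> complex"
  assumes "finite (set_pmf p)" "a > 0"
  shows "measure_pmf.prob p {x. a \<le> norm (Z x)}
    \<le> measure_pmf.expectation p (\<lambda>x. (norm (Z x))\<^sup>2) / a\<^sup>2"
  using measure_pmf.second_moment_method[of "\<lambda>x. norm (Z x)" p a] assms
  by (simp add: integrable_measure_pmf_finite)

lemma expectation_bind_le:
  fixes h :: "'b \<Rightarrow> real"
  assumes "finite (set_pmf p)" "\<And>x. x \<in> set_pmf p \<Longrightarrow> finite (set_pmf (K x))"
    and "\<And>x. x \<in> set_pmf p \<Longrightarrow> measure_pmf.expectation (K x) h \<le> k x"
  shows "measure_pmf.expectation (bind_pmf p K) h \<le> measure_pmf.expectation p k"
proof -
  have "measure_pmf.expectation (bind_pmf p K) h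
      = (\<Sum>a\<in>set_pmf p. pmf p a * measure_pmf.expectation (K a) h)"
    using assms by (simp add: pmf_expectation_bind[of "set_pmf p"])
  also have "\<dots> \<le> (\<Sum>a\<in>set_pmf p. pmf p a * k a)"
    using assms by (intro sum_mono mult_left_mono) auto
  also have "\<dots> = measure_pmf.expectation p k"
    using assms(1) by (subst integral_measure_pmf[of "set_pmf p"]) auto
  finally show ?thesis .
qed

text \<open>
  Pythagoras: a centred random variable is orthogonal to constants.  This is what makes the
  second moment recursion of one step additive.
\<close>

lemma sum_norm_square_shift:
  fixes Y :: "'m \<Rightarrow> complex"
  assumes "(\<Sum>j\<in>M. Y j) = 0"
  shows "(\<Sum>j\<in>M. (norm (Y j + c))\<^sup>2) = (\<Sum>j\<in>M. (norm (Y j))\<^sup>2) + real (card M) * (norm c)\<^sup>2"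
proof -
  have "(norm (Y j + c))\<^sup>2 = (norm (Y j))\<^sup>2 + (norm c)\<^sup>2 + 2 * Re (Y j * cnj c)" for j
    unfolding cmod_power2 by (simp add: power2_eq_square algebra_simps)
  moreover have "(\<Sum>j\<in>M. Re (Y j * cnj c)) = 0"
    using assms by (metis Re_sum mult_zero_left sum_distrib_right zero_complex.simps(1))
  ultimately show ?thesis
    by (simp add: sum.distrib flip: sum_distrib_left)
qed

definition random_move :: "'m set \<Rightarrow> ('m \<Rightarrow> 's \<Rightarrow> 's) \<Rightarrow> 's \<Rightarrow> 's pmf" where
  "random_move M act s = map_pmf (\<lambda>j. act j s) (pmf_of_set M)"

text \<open>
  The walk is run together with the product of the phases of the moves made so far.  The product
  cannot be read off from the state, so it has to be part of it.
\<close>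

definition phased :: "('m \<Rightarrow> 's \<Rightarrow> 's) \<Rightarrow> ('m \<Rightarrow> complex) \<Rightarrow> 'm \<Rightarrow> 's \<times> complex \<Rightarrow> 's \<times> complex" where
  "phased act \<tau> j = (\<lambda>(s, u). (act j s, \<tau> j * u))"

lemma law_after_Suc: "law_after K s (Suc t) = bind_pmf (law_after K s t) K"
  by (simp add: law_after_def)

lemma law_after_0 [simp]: "law_after K s 0 = return_pmf s"
  by (simp add: law_after_def)

lemma map_fst_law_after_phased:
  "map_pmf fst (law_after (random_move M (phased act \<tau>)) (s, u) t) = law_after (random_move M act) s t"
proof (induction t)
  case (Suc t)
  have "map_pmf fst (random_move M (phased act \<tau>) x) = random_move M act (fst x)" for x
    by (simp add: random_move_def pmf.map_comp o_def phased_def case_prod_unfold)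
  then have "map_pmf fst (law_after (random_move M (phased act \<tau>)) (s, u) (Suc t))
      = bind_pmf (map_pmf fst (law_after (random_move M (phased act \<tau>)) (s, u) t)) (random_move M act)"
    by (simp add: law_after_Suc map_bind_pmf bind_map_pmf)
  then show ?case
    by (simp add: Suc law_after_Suc)
qed simp

text \<open>
  \<open>\<Phi>\<close> is an eigenfunction once every move is weighted with its phase.  \<open>B\<close> is any number that
  the recursion \<open>V \<mapsto> \<rho>\<^sup>2 + (norm \<kappa>)\<^sup>2 * V\<close> of the second moments does not push beyond itself.
\<close>

locale twisted_eigenfunction =
  fixes M :: "'m set" and act :: "'m \<Rightarrow> 's \<Rightarrow> 's" and S :: "'s set"
    and \<tau> :: "'m \<Rightarrow> complex" and \<Phi> :: "'s \<Rightarrow> complex" and \<kappa> :: complex and \<rho> B :: real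
  assumes finite_moves: "finite M" and moves_nonempty: "M \<noteq> {}"
    and finite_states: "finite S"
    and act_bij: "j \<in> M \<Longrightarrow> bij_betw (act j) S S"
    and norm_phase: "j \<in> M \<Longrightarrow> norm (\<tau> j) = 1"
    and eigen: "s \<in> S \<Longrightarrow> (\<Sum>j\<in>M. \<tau> j * \<Phi> (act j s)) = of_nat (card M) * \<kappa> * \<Phi> s"
    and fluctuation: "j \<in> M \<Longrightarrow> s \<in> S \<Longrightarrow> norm (\<tau> j * \<Phi> (act j s) - \<kappa> * \<Phi> s) \<le> \<rho>"
    and variance_budget: "0 \<le> B" "\<rho>\<^sup>2 \<le> (1 - (norm \<kappa>)\<^sup>2) * B"
    and contracting: "norm \<kappa> < 1"
begin

lemma card_moves_pos: "0 < card M"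
  using finite_moves moves_nonempty by (simp add: card_gt_0_iff)

lemma one_step_second_moment:
  assumes "s \<in> S"
  shows "(\<Sum>j\<in>M. (norm (\<tau> j * \<Phi> (act j s) - \<kappa> * \<Phi> s + \<kappa> * c))\<^sup>2)
    \<le> real (card M) * (\<rho>\<^sup>2 + (norm \<kappa>)\<^sup>2 * (norm c)\<^sup>2)"
proof -
  have "(\<Sum>j\<in>M. \<tau> j * \<Phi> (act j s) - \<kappa> * \<Phi> s) = 0"
    using eigen[OF assms] by (simp add: sum_subtractf)
  then have "(\<Sum>j\<in>M. (norm (\<tau> j * \<Phi> (act j s) - \<kappa> * \<Phi> s + \<kappa> * c))\<^sup>2)
      = (\<Sum>j\<in>M. (norm (\<tau> j * \<Phi> (act j s) - \<kappa> * \<Phi> s))\<^sup>2) + real (card M) * (norm (\<kappa> * c))\<^sup>2"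
    by (rule sum_norm_square_shift)
  also have "(\<Sum>j\<in>M. (norm (\<tau> j * \<Phi> (act j s) - \<kappa> * \<Phi> s))\<^sup>2) \<le> (\<Sum>j\<in>M. \<rho>\<^sup>2)"
    using fluctuation assms by (intro sum_mono power_mono) auto
  finally show ?thesis
    by (simp add: norm_mult power_mult_distrib algebra_simps)
qed

abbreviation phased_law :: "'s \<Rightarrow> nat \<Rightarrow> ('s \<times> complex) pmf" where
  "phased_law s t \<equiv> law_after (random_move M (phased act \<tau>)) (s, 1) t"

lemma set_phased_law:
  assumes "s \<in> S"
  shows "finite (set_pmf (phased_law s t)) \<and> set_pmf (phased_law s t) \<subseteq> S \<times> {u. norm u = 1}"
proof (induction t)
  case (Suc t)
  have "finite (set_pmf (random_move M (phased act \<tau>) x))" for x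
    using finite_moves moves_nonempty by (simp add: random_move_def)
  moreover have "set_pmf (random_move M (phased act \<tau>) x) \<subseteq> S \<times> {u. norm u = 1}"
    if "x \<in> S \<times> {u. norm u = 1}" for x
    using that finite_moves moves_nonempty bij_betwE[OF act_bij]
    by (auto simp: random_move_def phased_def norm_mult norm_phase)
  ultimately show ?case
    using Suc unfolding law_after_Suc set_bind_pmf by blast
qed (use assms in simp)

text \<open>
  Each step multiplies the deviation from the mean by \<open>\<kappa>\<close> and adds a centred error of modulus at
  most \<open>\<rho>\<close>, so the variance obeys the recursion that \<open>B\<close> is made for.
\<close>

lemma second_moment_around_mean:
  assumes s: "s \<in> S"
  shows "measure_pmf.expectation (phased_law s t) (\<lambda>(x, u). (norm (u * \<Phi> x - \<kappa> ^ t * \<Phi> s))\<^sup>2) \<le> B"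
proof (induction t)
  case 0
  then show ?case using variance_budget by simp
next
  case (Suc t)
  let ?L = "phased_law s t"
  have fin: "finite (set_pmf ?L)" using set_phased_law[OF s] by blast
  have step: "measure_pmf.expectation (random_move M (phased act \<tau>) y)
        (\<lambda>(x, u). (norm (u * \<Phi> x - \<kappa> ^ Suc t * \<Phi> s))\<^sup>2)
      \<le> (case y of (x, u) \<Rightarrow> \<rho>\<^sup>2 + (norm \<kappa>)\<^sup>2 * (norm (u * \<Phi> x - \<kappa> ^ t * \<Phi> s))\<^sup>2)"
    if "y \<in> set_pmf ?L" for y
  proof -
    obtain x u where y: "y = (x, u)" by (cases y)
    have x: "x \<in> S" and u: "norm u = 1" using that set_phased_law[OF s, of t] y by auto
    \<comment> \<open>Dividing by \<open>u\<close> turns the claim into the one-step estimate, which has no phase.\<close>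
    have uu: "u * cnj u = 1" using complex_norm_square[of u] by (simp add: u)
    have "norm (\<tau> j * u * \<Phi> (act j x) - \<kappa> ^ Suc t * \<Phi> s)
        = norm (\<tau> j * \<Phi> (act j x) - \<kappa> * \<Phi> x + \<kappa> * (cnj u * (u * \<Phi> x - \<kappa> ^ t * \<Phi> s)))" for j
    proof -
      have "u * (\<tau> j * \<Phi> (act j x) - \<kappa> * \<Phi> x + \<kappa> * (cnj u * (u * \<Phi> x - \<kappa> ^ t * \<Phi> s)))
          = \<tau> j * u * \<Phi> (act j x) - u * \<kappa> * \<Phi> x + (u * cnj u) * (\<kappa> * (u * \<Phi> x - \<kappa> ^ t * \<Phi> s))"
        by (simp only: algebra_simps)
      also have "\<dots> = \<tau> j * u * \<Phi> (act j x) - \<kappa> ^ Suc t * \<Phi> s"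
        unfolding uu by (simp add: algebra_simps)
      finally have eq: "\<tau> j * u * \<Phi> (act j x) - \<kappa> ^ Suc t * \<Phi> s
          = u * (\<tau> j * \<Phi> (act j x) - \<kappa> * \<Phi> x + \<kappa> * (cnj u * (u * \<Phi> x - \<kappa> ^ t * \<Phi> s)))"
        by (rule sym)
      show ?thesis unfolding eq by (simp add: norm_mult u)
    qed
    then have "(\<Sum>j\<in>M. (norm (\<tau> j * u * \<Phi> (act j x) - \<kappa> ^ Suc t * \<Phi> s))\<^sup>2)
        \<le> real (card M) * (\<rho>\<^sup>2 + (norm \<kappa>)\<^sup>2 * (norm (cnj u * (u * \<Phi> x - \<kappa> ^ t * \<Phi> s)))\<^sup>2)"
      using one_step_second_moment[OF x, of "cnj u * (u * \<Phi> x - \<kappa> ^ t * \<Phi> s)"]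
      by (simp only: simp_thms)
    then have "(\<Sum>j\<in>M. (norm (\<tau> j * u * \<Phi> (act j x) - \<kappa> ^ Suc t * \<Phi> s))\<^sup>2) / card M
        \<le> \<rho>\<^sup>2 + (norm \<kappa>)\<^sup>2 * (norm (u * \<Phi> x - \<kappa> ^ t * \<Phi> s))\<^sup>2"
      using card_moves_pos
      by (simp only: norm_mult[of "cnj u"] complex_mod_cnj u mult_1_left)
         (simp add: divide_le_eq mult.commute)
    then show ?thesis
      by (simp add: y random_move_def phased_def integral_pmf_of_set finite_moves moves_nonempty)
  qed
  have "measure_pmf.expectation (phased_law s (Suc t)) (\<lambda>(x, u). (norm (u * \<Phi> x - \<kappa> ^ Suc t * \<Phi> s))\<^sup>2)
      \<le> measure_pmf.expectation ?L (\<lambda>(x, u). \<rho>\<^sup>2 + (norm \<kappa>)\<^sup>2 * (norm (u * \<Phi> x - \<kappa> ^ t * \<Phi> s))\<^sup>2)"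
    unfolding law_after_Suc
    by (rule expectation_bind_le[OF fin _ step])
       (use finite_moves moves_nonempty in \<open>simp add: random_move_def\<close>)
  also have "\<dots> = \<rho>\<^sup>2 + (norm \<kappa>)\<^sup>2 *
      measure_pmf.expectation ?L (\<lambda>(x, u). (norm (u * \<Phi> x - \<kappa> ^ t * \<Phi> s))\<^sup>2)"
    unfolding case_prod_unfold using fin by (simp add: integrable_measure_pmf_finite)
  also have "\<dots> \<le> \<rho>\<^sup>2 + (norm \<kappa>)\<^sup>2 * B"
    using Suc by (intro add_left_mono mult_left_mono) auto
  also have "\<dots> \<le> B" using variance_budget by (simp add: algebra_simps)
  finally show ?case .
qed

text \<open>
  The uniform distribution is invariant under every move, so one step leaves the second moment
  unchanged, while the one-step estimate contracts it: it is at most the fixed point.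
\<close>

lemma uniform_second_moment:
  assumes "S \<noteq> {}"
  shows "measure_pmf.expectation (pmf_of_set S) (\<lambda>s. (norm (\<Phi> s))\<^sup>2) \<le> B"
proof -
  let ?V = "\<Sum>s\<in>S. (norm (\<Phi> s))\<^sup>2"
  have "real (card M) * ?V = (\<Sum>j\<in>M. \<Sum>s\<in>S. (norm (\<tau> j * \<Phi> (act j s)))\<^sup>2)"
  proof -
    have "(\<Sum>s\<in>S. (norm (\<tau> j * \<Phi> (act j s)))\<^sup>2) = ?V" if "j \<in> M" for j
      using sum.reindex_bij_betw[OF act_bij[OF that], of "\<lambda>s. (norm (\<Phi> s))\<^sup>2"] norm_phase[OF that]
      by (simp add: norm_mult)
    then show ?thesis by simp
  qed
  also have "\<dots> = (\<Sum>s\<in>S. \<Sum>j\<in>M. (norm (\<tau> j * \<Phi> (act j s) - \<kappa> * \<Phi> s + \<kappa> * \<Phi> s))\<^sup>2)"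
    by (subst sum.swap) simp
  also have "\<dots> \<le> (\<Sum>s\<in>S. real (card M) * (\<rho>\<^sup>2 + (norm \<kappa>)\<^sup>2 * (norm (\<Phi> s))\<^sup>2))"
    by (intro sum_mono one_step_second_moment)
  also have "\<dots> = real (card M) * (real (card S) * \<rho>\<^sup>2 + (norm \<kappa>)\<^sup>2 * ?V)"
    by (simp add: sum.distrib flip: sum_distrib_left)
  finally have "?V \<le> real (card S) * \<rho>\<^sup>2 + (norm \<kappa>)\<^sup>2 * ?V"
    using card_moves_pos by simp
  then have "(1 - (norm \<kappa>)\<^sup>2) * ?V \<le> real (card S) * \<rho>\<^sup>2" by (simp add: algebra_simps)
  also have "\<dots> \<le> real (card S) * ((1 - (norm \<kappa>)\<^sup>2) * B)"
    using variance_budget by (intro mult_left_mono) auto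
  finally have "(1 - (norm \<kappa>)\<^sup>2) * ?V \<le> (1 - (norm \<kappa>)\<^sup>2) * (real (card S) * B)"
    by (simp add: algebra_simps)
  moreover have "0 < 1 - (norm \<kappa>)\<^sup>2"
    using contracting by (simp add: power_less_one_iff)
  ultimately have "?V \<le> real (card S) * B" by simp
  then show ?thesis
    using assms finite_states
    by (simp add: integral_pmf_of_set divide_simps mult.commute card_gt_0_iff)
qed

text \<open>
  The distinguishing event is that the modulus of \<open>\<Phi>\<close> is at least half of the modulus of its
  twisted mean; both error probabilities are bounded by Chebyshev's inequality.
\<close>

theorem tv_dist_lower_bound:
  assumes s: "s \<in> S" and big: "\<kappa> ^ t * \<Phi> s \<noteq> 0"
  shows "1 - 8 * B / (norm (\<kappa> ^ t * \<Phi> s))\<^sup>2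
    \<le> tv_dist (law_after (random_move M act) s t) (pmf_of_set S)"
proof -
  define m where "m = norm (\<kappa> ^ t * \<Phi> s)"
  have m: "m > 0" using big unfolding m_def by simp
  define A where "A = {x. norm (\<Phi> x) < m / 2}"
  let ?L = "phased_law s t"
  have S0: "S \<noteq> {}" using s by auto
  have "measure_pmf.prob (law_after (random_move M act) s t) A = measure_pmf.prob ?L (fst -` A)"
    by (subst map_fst_law_after_phased[symmetric]) (rule measure_map_pmf)
  also have "\<dots> \<le> measure_pmf.prob ?L {y. m / 2 \<le> norm (snd y * \<Phi> (fst y) - \<kappa> ^ t * \<Phi> s)}"
  proof (rule measure_pmf.finite_measure_mono_AE)
    have "m / 2 \<le> norm (snd y * \<Phi> (fst y) - \<kappa> ^ t * \<Phi> s)"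
      if "y \<in> set_pmf ?L" "fst y \<in> A" for y
    proof -
      have "norm (snd y) = 1" using that set_phased_law[OF s, of t] by auto
      then have "norm (snd y * \<Phi> (fst y)) < m / 2"
        using that by (simp add: A_def norm_mult)
      moreover have "m \<le> norm (snd y * \<Phi> (fst y)) + norm (snd y * \<Phi> (fst y) - \<kappa> ^ t * \<Phi> s)"
        unfolding m_def using norm_triangle_ineq4[of "snd y * \<Phi> (fst y)" "snd y * \<Phi> (fst y) - \<kappa> ^ t * \<Phi> s"]
        by simp
      ultimately show ?thesis by linarith
    qed
    then show "AE y in ?L. y \<in> fst -` A \<longrightarrow> y \<in> {y. m / 2 \<le> norm (snd y * \<Phi> (fst y) - \<kappa> ^ t * \<Phi> s)}"
      by (auto simp: AE_measure_pmf_iff)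
  qed simp
  also have "\<dots> \<le> measure_pmf.expectation ?L (\<lambda>y. (norm (snd y * \<Phi> (fst y) - \<kappa> ^ t * \<Phi> s))\<^sup>2) / (m / 2)\<^sup>2"
    using set_phased_law[OF s] m by (intro prob_norm_ge_le_second_moment) auto
  also have "\<dots> \<le> B / (m / 2)\<^sup>2"
    using second_moment_around_mean[OF s, of t]
    by (intro divide_right_mono) (auto simp: case_prod_unfold)
  finally have walk: "measure_pmf.prob (law_after (random_move M act) s t) A \<le> 4 * B / m\<^sup>2"
    by (simp add: power2_eq_square mult.commute)
  have "measure_pmf.prob (pmf_of_set S) (- A) \<le> measure_pmf.expectation (pmf_of_set S) (\<lambda>x. (norm (\<Phi> x))\<^sup>2) / (m / 2)\<^sup>2"
    using prob_norm_ge_le_second_moment[of "pmf_of_set S" "m / 2" \<Phi>] finite_states S0 m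
    by (simp add: A_def Collect_neg_eq[symmetric] not_less)
  also have "\<dots> \<le> B / (m / 2)\<^sup>2"
    by (intro divide_right_mono uniform_second_moment S0) simp
  finally have "measure_pmf.prob (pmf_of_set S) (- A) \<le> 4 * B / m\<^sup>2"
    by (simp add: power2_eq_square mult.commute)
  moreover have "measure_pmf.prob (pmf_of_set S) (- A) = 1 - measure_pmf.prob (pmf_of_set S) A"
    using measure_pmf.prob_compl[of A "pmf_of_set S"] by (simp add: Compl_eq_Diff_UNIV)
  ultimately show ?thesis
    using walk tv_dist_ge_prob_diff[of "law_after (random_move M act) s t" A "pmf_of_set S"]
    by (simp add: m_def)
qed

end

section \<open>Modes of a single card\<close>

text \<open>
  \<open>\<sigma>\<close> takes a card along: the card at position \<open>i\<close> before the move \<open>m\<close> is at position \<open>\<sigma> i\<close>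
  afterwards.  Position 0 is the top of the deck.
\<close>

definition moves_positions :: "nat \<Rightarrow> ('a list \<Rightarrow> 'a list) \<Rightarrow> (nat \<Rightarrow> nat) \<Rightarrow> bool" where
  "moves_positions n m \<sigma> \<longleftrightarrow> bij_betw \<sigma> {..<n} {..<n} \<and>
     (\<forall>xs. length xs = n \<longrightarrow> length (m xs) = n \<and> (\<forall>i<n. m xs ! \<sigma> i = xs ! i))"

lemma moves_positionsI:
  assumes "\<And>i. i < n \<Longrightarrow> \<sigma> i < n" "inj_on \<sigma> {..<n}"
    and "\<And>xs. length xs = n \<Longrightarrow> length (m xs) = n"
    and "\<And>xs i. length xs = n \<Longrightarrow> i < n \<Longrightarrow> m xs ! \<sigma> i = xs ! i"
  shows "moves_positions n m \<sigma>"
proof -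
  have "\<sigma> ` {..<n} = {..<n}" using assms(1,2) by (intro endo_inj_surj) auto
  then show ?thesis using assms by (simp add: moves_positions_def bij_betw_def)
qed

text \<open>
  Moving the cards is the same as composing the function of the position with \<open>\<sigma>\<close>; this
  reduces eigenfunctions on decks to eigenfunctions on positions.
\<close>

lemma sum_cards_after_move:
  fixes f :: "nat \<Rightarrow> 'b::comm_semiring_1"
  assumes "moves_positions n m \<sigma>" "length xs = n"
  shows "(\<Sum>i<n. \<alpha> (m xs ! i) * f i) = (\<Sum>i<n. \<alpha> (xs ! i) * f (\<sigma> i))"
proof -
  have "(\<Sum>i<n. \<alpha> (m xs ! i) * f i) = (\<Sum>i<n. \<alpha> (m xs ! \<sigma> i) * f (\<sigma> i))"
    using assms by (intro sum.reindex_bij_betw[symmetric]) (simp add: moves_positions_def)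
  also have "\<dots> = (\<Sum>i<n. \<alpha> (xs ! i) * f (\<sigma> i))"
    using assms by (intro sum.cong) (auto simp: moves_positions_def)
  finally show ?thesis .
qed

lemma length_deck: "xs \<in> permutations_of_set {..<n::nat} \<Longrightarrow> length xs = n"
  by (simp add: length_finite_permutations_of_set)

lemma bij_betw_decks:
  assumes m: "moves_positions n m \<sigma>"
  shows "bij_betw m (permutations_of_set {..<n::nat}) (permutations_of_set {..<n})"
proof -
  let ?D = "permutations_of_set {..<n}"
  have \<sigma>: "\<sigma> ` {..<n} = {..<n}" using m by (simp add: moves_positions_def bij_betw_def)
  have maps: "m xs \<in> ?D" if xs: "xs \<in> ?D" for xs
  proof -
    have len: "length xs = n" "length (m xs) = n"
      using length_deck[OF xs] m by (auto simp: moves_positions_def)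
    have "set (m xs) = (\<lambda>i. m xs ! i) ` \<sigma> ` {..<n}"
      unfolding \<sigma> using len(2) by (auto simp: set_conv_nth)
    also have "\<dots> = (\<lambda>i. xs ! i) ` {..<n}"
      using m len by (auto simp: moves_positions_def image_image intro!: image_cong)
    also have "\<dots> = {..<n}"
      using xs len by (auto simp: permutations_of_set_def set_conv_nth)
    finally have set: "set (m xs) = {..<n}" .
    then have "distinct (m xs)" using len by (simp add: card_distinct)
    with set show ?thesis by (simp add: permutations_of_set_def)
  qed
  have inj: "inj_on m ?D"
  proof (rule inj_onI)
    fix xs ys assume *: "xs \<in> ?D" "ys \<in> ?D" "m xs = m ys"
    have len: "length xs = n" "length ys = n" using * length_deck by blast+
    show "xs = ys"
    proof (rule nth_equalityI)
      fix i assume "i < length xs"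
      then show "xs ! i = ys ! i" using m len *(3) unfolding moves_positions_def by metis
    qed (simp add: len)
  qed
  moreover have "m ` ?D = ?D"
    using maps inj by (intro endo_inj_surj) auto
  ultimately show ?thesis by (simp add: bij_betw_def)
qed

text \<open>
  \<open>f\<close> is a twisted eigenfunction for the position of one card, comparable to 1 everywhere.  The
  last condition says that a single move changes \<open>f\<close>, up to the factor \<open>\<kappa>\<close> and the phase, by
  \<open>O(1/n)\<close> in total over all positions; this is what keeps the fluctuation of the sum over all
  cards at \<open>O(1/n)\<close>.
\<close>

definition slow_mode :: "nat \<Rightarrow> 'm set \<Rightarrow> ('m \<Rightarrow> nat \<Rightarrow> nat) \<Rightarrow> real \<Rightarrow> complex \<Rightarrow> bool" where
  "slow_mode n M \<sigma> C \<kappa> \<longleftrightarrow> (\<exists>\<tau> f.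
     (\<forall>j\<in>M. norm (\<tau> j) = 1) \<and>
     (\<forall>i<n. (\<Sum>j\<in>M. \<tau> j * f (\<sigma> j i)) = of_nat (card M) * \<kappa> * f i) \<and>
     (\<forall>i<n. 1 / 2 \<le> norm (f i) \<and> norm (f i) \<le> 2) \<and>
     (\<forall>j\<in>M. (\<Sum>i<n. norm (\<tau> j * f (\<sigma> j i) - \<kappa> * f i)) \<le> C / real n))"

text \<open>
  The statistic \<open>\<Phi>\<close> weights the mode of each card with the conjugate of the mode at the card's
  starting position.  At the start all terms are then squared moduli and add up to order \<open>n\<close>.
\<close>

lemma tv_dist_ge_if_slow_mode:
  fixes act :: "'m \<Rightarrow> nat list \<Rightarrow> nat list"
  assumes M: "finite M" "M \<noteq> {}" and n: "0 < n"
    and pos: "\<And>j. j \<in> M \<Longrightarrow> moves_positions n (act j) (\<sigma> j)"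
    and slow: "slow_mode n M \<sigma> C \<kappa>"
    and \<kappa>: "norm \<kappa> < 1" "\<kappa> \<noteq> 0"
    and start: "start \<in> permutations_of_set {..<n}"
  shows "1 - 512 * C\<^sup>2 / (real n ^ 4 * (1 - (norm \<kappa>)\<^sup>2) * ((norm \<kappa>)\<^sup>2) ^ t)
    \<le> tv_dist (law_after (random_move M act) start t) (uniform_deck n)"
proof -
  obtain \<tau> f where \<tau>: "\<And>j. j \<in> M \<Longrightarrow> norm (\<tau> j) = 1"
    and eig: "\<And>i. i < n \<Longrightarrow> (\<Sum>j\<in>M. \<tau> j * f (\<sigma> j i)) = of_nat (card M) * \<kappa> * f i"
    and f: "\<And>i. i < n \<Longrightarrow> 1 / 2 \<le> norm (f i)" "\<And>i. i < n \<Longrightarrow> norm (f i) \<le> 2"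
    and drift: "\<And>j. j \<in> M \<Longrightarrow> (\<Sum>i<n. norm (\<tau> j * f (\<sigma> j i) - \<kappa> * f i)) \<le> C / real n"
    using slow unfolding slow_mode_def by blast
  let ?D = "permutations_of_set {..<n}"
  have len: "length start = n" and dist: "distinct start" and set: "set start = {..<n}"
    using start length_deck by (auto simp: permutations_of_set_def)
  have "\<forall>c\<in>{..<n}. \<exists>i<n. start ! i = c"
    using set len by (metis in_set_conv_nth)
  then obtain idx where idx: "\<And>c. c < n \<Longrightarrow> idx c < n \<and> start ! idx c = c" by (metis lessThan_iff)
  have idx_start: "idx (start ! i) = i" if "i < n" for i
    using that idx[of "start ! i"] len dist set by (metis lessThan_iff nth_eq_iff_index_eq nth_mem)
  define \<Phi> where "\<Phi> xs = (\<Sum>i<n. cnj (f (idx (xs ! i))) * f i)" for xs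
  have norm_weight: "norm (cnj (f (idx (xs ! i)))) \<le> 2" if "xs \<in> ?D" "i < n" for xs i
  proof -
    have "xs ! i < n"
      using that length_deck[OF that(1)] nth_mem[of i xs] by (auto simp: permutations_of_set_def)
    then show ?thesis using f(2) idx by simp
  qed
  have \<Phi>_move: "\<Phi> (act j xs) = (\<Sum>i<n. cnj (f (idx (xs ! i))) * f (\<sigma> j i))"
    if "j \<in> M" "xs \<in> ?D" for j xs
    unfolding \<Phi>_def using sum_cards_after_move[OF pos[OF that(1)] length_deck[OF that(2)]] .
  have \<kappa>2: "0 < 1 - (norm \<kappa>)\<^sup>2" using \<kappa> by (simp add: power_less_one_iff)
  define \<rho> where "\<rho> = 2 * (C / real n)"
  define B where "B = \<rho>\<^sup>2 / (1 - (norm \<kappa>)\<^sup>2)"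
  interpret twisted_eigenfunction M act ?D \<tau> \<Phi> \<kappa> \<rho> B
  proof
    fix xs assume xs: "xs \<in> ?D"
    have "(\<Sum>j\<in>M. \<tau> j * \<Phi> (act j xs)) = (\<Sum>j\<in>M. \<Sum>i<n. cnj (f (idx (xs ! i))) * (\<tau> j * f (\<sigma> j i)))"
      by (intro sum.cong refl) (simp add: \<Phi>_move[OF _ xs] sum_distrib_left mult_ac)
    also have "\<dots> = (\<Sum>i<n. cnj (f (idx (xs ! i))) * (\<Sum>j\<in>M. \<tau> j * f (\<sigma> j i)))"
      by (subst sum.swap) (simp add: sum_distrib_left)
    also have "\<dots> = of_nat (card M) * \<kappa> * \<Phi> xs"
      unfolding \<Phi>_def sum_distrib_left[of "of_nat (card M) * \<kappa>"]
      by (intro sum.cong refl) (subst eig, auto)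
    finally show "(\<Sum>j\<in>M. \<tau> j * \<Phi> (act j xs)) = of_nat (card M) * \<kappa> * \<Phi> xs" .
  next
    fix j xs assume j: "j \<in> M" and xs: "xs \<in> ?D"
    have "\<tau> j * \<Phi> (act j xs) - \<kappa> * \<Phi> xs
        = (\<Sum>i<n. cnj (f (idx (xs ! i))) * (\<tau> j * f (\<sigma> j i) - \<kappa> * f i))"
      unfolding \<Phi>_move[OF j xs] unfolding \<Phi>_def
      by (simp add: sum_distrib_left sum_subtractf algebra_simps)
    also have "norm \<dots> \<le> (\<Sum>i<n. 2 * norm (\<tau> j * f (\<sigma> j i) - \<kappa> * f i))"
      using norm_weight[OF xs] by (intro sum_norm_le) (simp add: norm_mult mult_right_mono)
    also have "\<dots> \<le> \<rho>"
      unfolding \<rho>_def using drift[OF j] by (simp flip: sum_distrib_left)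
    finally show "norm (\<tau> j * \<Phi> (act j xs) - \<kappa> * \<Phi> xs) \<le> \<rho>" .
  qed (use M \<tau> \<kappa> \<kappa>2 bij_betw_decks[OF pos] in \<open>auto simp: B_def\<close>)
  have \<Phi>_start: "\<Phi> start = of_real (\<Sum>i<n. (norm (f i))\<^sup>2)"
    unfolding \<Phi>_def of_real_sum
    by (intro sum.cong refl) (simp add: idx_start mult.commute flip: complex_norm_square)
  have "(\<Sum>i<n. (1/2)\<^sup>2) \<le> (\<Sum>i<n. (norm (f i))\<^sup>2)"
    using f(1) by (intro sum_mono power_mono) auto
  then have big: "real n / 4 \<le> norm (\<Phi> start)"
    unfolding \<Phi>_start norm_of_real by (simp add: power2_eq_square sum_nonneg)
  have \<kappa>t: "0 < ((norm \<kappa>)\<^sup>2) ^ t" using \<kappa> by simp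
  have "8 * B / (norm (\<kappa> ^ t * \<Phi> start))\<^sup>2 = 8 * B / (((norm \<kappa>)\<^sup>2) ^ t * (norm (\<Phi> start))\<^sup>2)"
    by (simp add: norm_mult norm_power power_mult_distrib power_mult[symmetric] mult.commute)
  also have "\<dots> \<le> 8 * B / (((norm \<kappa>)\<^sup>2) ^ t * (real n / 4)\<^sup>2)"
    using big \<kappa>t n variance_budget(1)
    by (intro divide_left_mono mult_left_mono power_mono mult_pos_pos) auto
  \<comment> \<open>\<open>512 = 8 * 2\<^sup>2 * 4\<^sup>2\<close>: the weights are at most 2 and the initial value at least \<open>n / 4\<close>.\<close>
  also have "\<dots> = 512 * C\<^sup>2 / (real n ^ 4 * (1 - (norm \<kappa>)\<^sup>2) * ((norm \<kappa>)\<^sup>2) ^ t)"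
    using n by (simp add: B_def \<rho>_def power2_eq_square power4_eq_xxxx field_simps)
  finally have "8 * B / (norm (\<kappa> ^ t * \<Phi> start))\<^sup>2
      \<le> 512 * C\<^sup>2 / (real n ^ 4 * (1 - (norm \<kappa>)\<^sup>2) * ((norm \<kappa>)\<^sup>2) ^ t)" .
  moreover have "\<kappa> ^ t * \<Phi> start \<noteq> 0" using \<kappa> big n by auto
  ultimately show ?thesis
    using tv_dist_lower_bound[OF start, of t] by (simp add: uniform_deck_def)
qed

section \<open>From the spectral gap to the mixing time\<close>

lemma one_minus_power_ge_exp:
  fixes x :: real
  assumes "0 \<le> x" "x < 1"
  shows "exp (- (real t * (x / (1 - x)))) \<le> (1 - x) ^ t"
proof -
  have "ln (1 / (1 - x)) \<le> 1 / (1 - x) - 1"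
    using assms by (intro ln_le_minus_one) simp
  then have "- (x / (1 - x)) \<le> ln (1 - x)"
    using assms by (simp add: ln_div field_simps)
  then have "exp (real t * - (x / (1 - x))) \<le> exp (real t * ln (1 - x))"
    unfolding exp_le_cancel_iff by (rule mult_left_mono) simp
  also have "\<dots> = (1 - x) ^ t"
    using assms by (simp add: exp_of_nat_mult)
  finally show ?thesis by simp
qed

text \<open>
  With \<open>1 - x\<close> the squared modulus of the eigenvalue, the slack \<open>\<eta>\<close> in the number of steps pays
  for the error \<open>\<eta> / 2\<close> in the gap and for the second order of the logarithm, and a margin of
  \<open>\<eta> / 2\<close> is left in the exponent of \<open>n\<close>.
\<close>

lemma power_gap_ge:
  fixes x \<eta> g :: real
  assumes g: "g > 0" and \<eta>: "0 < \<eta>" "\<eta> < 1" and n: "n \<ge> 1"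
    and x: "0 \<le> x" "x \<le> 2 * g * (1 + \<eta> / 2) / real n ^ 3" "x \<le> \<eta>\<^sup>2 / 2"
    and t: "real t \<le> (1 - \<eta>) / (2 * g) * real n ^ 3 * ln (real n)"
  shows "real n powr (\<eta> / 2 - 1) \<le> (1 - x) ^ t"
proof -
  have \<eta>2: "\<eta>\<^sup>2 < 1" using \<eta> by (simp add: power_less_one_iff)
  have x1: "x < 1" using x(3) \<eta>2 by simp
  have ln0: "0 \<le> ln (real n)" using n by simp
  have n3: "0 < real n ^ 3" using n by simp
  have "real t * x \<le> ((1 - \<eta>) / (2 * g) * real n ^ 3 * ln (real n)) * (2 * g * (1 + \<eta> / 2) / real n ^ 3)"
    using t x \<eta> g ln0 by (intro mult_mono) auto
  also have "\<dots> = (1 - \<eta>) * (1 + \<eta> / 2) * ln (real n)"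
    using g n3 by (simp add: field_simps)
  \<comment> \<open>The factor \<open>1 - x\<close> is needed below to absorb the denominator in \<open>- ln (1 - x) \<le> x / (1 - x)\<close>.\<close>
  also have "\<dots> \<le> ((1 - \<eta> / 2) * (1 - x)) * ln (real n)"
  proof (rule mult_right_mono[OF _ ln0])
    have "(1 - \<eta> / 2) * x \<le> \<eta>\<^sup>2 / 2"
      using x \<eta> mult_left_le_one_le[of x "1 - \<eta> / 2"] by linarith
    moreover have "(1 - \<eta>) * (1 + \<eta> / 2) = 1 - \<eta> / 2 - \<eta>\<^sup>2 / 2"
      by (simp add: field_simps power2_eq_square)
    moreover have "(1 - \<eta> / 2) * (1 - x) = 1 - \<eta> / 2 - (1 - \<eta> / 2) * x"
      by (simp only: right_diff_distrib mult_1_right)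
    ultimately show "(1 - \<eta>) * (1 + \<eta> / 2) \<le> (1 - \<eta> / 2) * (1 - x)"
      by linarith
  qed
  finally have "real t * x / (1 - x) \<le> (1 - \<eta> / 2) * ln (real n)"
    using x1 by (simp add: divide_simps algebra_simps)
  then have "exp (- ((1 - \<eta> / 2) * ln (real n))) \<le> exp (- (real t * (x / (1 - x))))"
    by simp
  also have "\<dots> \<le> (1 - x) ^ t"
    using x x1 by (intro one_minus_power_ge_exp) auto
  finally show ?thesis using n by (simp add: powr_def algebra_simps)
qed

text \<open>
  Diagonal argument: the slack \<open>1 / (k + 2)\<close> is used once the threshold belonging to it has been
  passed, with \<open>k\<close> as large as the current \<open>n\<close> permits.
\<close>

lemma vanishing_slack:
  fixes Q :: "real \<Rightarrow> nat \<Rightarrow> bool"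
  assumes "\<And>\<eta>. 0 < \<eta> \<Longrightarrow> \<eta> < 1 \<Longrightarrow> \<forall>\<^sub>F n in sequentially. Q \<eta> n"
  shows "\<exists>\<delta>. \<delta> \<longlonglongrightarrow> 0 \<and> (\<forall>\<^sub>F n in sequentially. Q (\<delta> n) n)"
proof -
  define e where "e k = 1 / (real k + 2)" for k
  have "\<forall>k. \<exists>N. \<forall>n\<ge>N. Q (e k) n"
  proof
    fix k
    have "\<forall>\<^sub>F n in sequentially. Q (e k) n" by (rule assms) (auto simp: e_def)
    then show "\<exists>N. \<forall>n\<ge>N. Q (e k) n" by (simp add: eventually_sequentially)
  qed
  then obtain N where N: "\<And>k n. N k \<le> n \<Longrightarrow> Q (e k) n" by metis
  define A where "A n = {k. k \<le> n \<and> N k \<le> n}" for n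
  \<comment> \<open>\<open>A n\<close> is nonempty as soon as \<open>n \<ge> N 0\<close>.\<close>
  define \<delta> where "\<delta> n = e (Max (A n))" for n
  have fin: "finite (A n)" for n by (simp add: A_def)
  have "Q (\<delta> n) n" if "n \<ge> N 0" for n
  proof -
    have "Max (A n) \<in> A n" using that fin by (intro Max_in) (auto simp: A_def)
    then show ?thesis unfolding \<delta>_def by (intro N) (simp add: A_def)
  qed
  then have "\<forall>\<^sub>F n in sequentially. Q (\<delta> n) n" by (auto simp: eventually_sequentially)
  moreover have "\<delta> \<longlonglongrightarrow> 0"
  proof (rule tendstoI)
    fix r :: real assume "0 < r"
    have "e \<longlonglongrightarrow> 0" unfolding e_def by real_asymp
    then obtain k where k: "e k < r"
      using \<open>0 < r\<close> by (metis (no_types, lifting) eventually_sequentially linorder_le_cases order_tendstoD(2))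
    have "dist (\<delta> n) 0 < r" if "n \<ge> max k (N k)" for n
    proof -
      have "k \<le> Max (A n)" using that fin by (intro Max_ge) (auto simp: A_def)
      then have "\<delta> n \<le> e k" by (simp add: \<delta>_def e_def frac_le)
      moreover have "0 \<le> \<delta> n" by (simp add: \<delta>_def e_def)
      ultimately show ?thesis using k by simp
    qed
    then show "\<forall>\<^sub>F n in sequentially. dist (\<delta> n) 0 < r" by (rule eventually_sequentiallyI)
  qed
  ultimately show ?thesis by blast
qed

text \<open>
  The squared relative error of the statistic at time \<open>t\<close> is
  \<open>O(1 / n) / ((norm \<kappa>)\<^sup>2) ^ t\<close>, because the variance is \<open>O(n)\<close> and the initial value of order \<open>n\<close>.
  For the number of steps considered this is \<open>O(n powr (- \<eta> / 2))\<close>.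
\<close>

theorem mixing_lower_bound:
  fixes act :: "'m \<Rightarrow> nat list \<Rightarrow> nat list"
  assumes M: "finite M" "M \<noteq> {}" and g: "g > 0" and c: "c > 0" and \<epsilon>: "\<epsilon> > 0"
    and pos: "\<forall>\<^sub>F n in sequentially. \<forall>j\<in>M. moves_positions n (act j) (\<sigma> n j)"
    and slow: "\<And>\<eta>. 0 < \<eta> \<Longrightarrow> \<eta> < 1 \<Longrightarrow> \<forall>\<^sub>F n in sequentially. \<exists>\<kappa>. slow_mode n M (\<sigma> n) C \<kappa> \<and>
        c / real n ^ 3 \<le> 1 - (norm \<kappa>)\<^sup>2 \<and> 1 - (norm \<kappa>)\<^sup>2 \<le> 2 * g * (1 + \<eta>) / real n ^ 3"
  shows "\<exists>\<delta> :: nat \<Rightarrow> real. \<delta> \<longlonglongrightarrow> 0 \<and> (\<forall>\<^sub>F n in sequentially. \<forall>start \<in> permutations_of_set {..<n}.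
      tv_dist (law_after (random_move M act) start
          (nat \<lfloor>(1 - \<delta> n) / (2 * g) * real n ^ 3 * ln (real n)\<rfloor>))
        (uniform_deck n) \<ge> 1 - \<epsilon>)"
proof (rule vanishing_slack)
  fix \<eta> :: real assume \<eta>: "0 < \<eta>" "\<eta> < 1"
  have lim: "(\<lambda>n. 512 * C\<^sup>2 / c * real n powr (- \<eta> / 2)) \<longlonglongrightarrow> 0"
    using \<eta> by real_asymp
  have small: "(\<lambda>n. 2 * g * (1 + \<eta> / 2) / real n ^ 3) \<longlonglongrightarrow> 0"
    by real_asymp
  have "0 < \<eta>\<^sup>2 / 2" using \<eta> by simp
  then have ev_small: "\<forall>\<^sub>F n in sequentially. 2 * g * (1 + \<eta> / 2) / real n ^ 3 < \<eta>\<^sup>2 / 2"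
    using small by (rule order_tendstoD(2)[rotated])
  have ev: "\<forall>\<^sub>F n in sequentially. 512 * C\<^sup>2 / c * real n powr (- \<eta> / 2) < \<epsilon>"
    using order_tendstoD(2)[OF lim \<epsilon>] .
  have slow': "\<forall>\<^sub>F n in sequentially. \<exists>\<kappa>. slow_mode n M (\<sigma> n) C \<kappa> \<and>
        c / real n ^ 3 \<le> 1 - (norm \<kappa>)\<^sup>2 \<and> 1 - (norm \<kappa>)\<^sup>2 \<le> 2 * g * (1 + \<eta> / 2) / real n ^ 3"
    using \<eta> by (intro slow) auto
  show "\<forall>\<^sub>F n in sequentially. \<forall>start \<in> permutations_of_set {..<n}.
      tv_dist (law_after (random_move M act) start
          (nat \<lfloor>(1 - \<eta>) / (2 * g) * real n ^ 3 * ln (real n)\<rfloor>))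
        (uniform_deck n) \<ge> 1 - \<epsilon>"
    using pos slow' ev_small ev eventually_ge_at_top[of "1::nat"]
  proof eventually_elim
    case (elim n)
    then obtain \<kappa> where \<kappa>: "slow_mode n M (\<sigma> n) C \<kappa>" "c / real n ^ 3 \<le> 1 - (norm \<kappa>)\<^sup>2"
        "1 - (norm \<kappa>)\<^sup>2 \<le> 2 * g * (1 + \<eta> / 2) / real n ^ 3" by blast
    have n: "n \<ge> 1" by fact
    define x where "x = 1 - (norm \<kappa>)\<^sup>2"
    have x0: "0 < x" using \<kappa>(2) c n by (smt (verit) x_def divide_pos_pos of_nat_0_less_iff zero_less_power less_le_trans zero_less_one)
    have x_small: "x \<le> \<eta>\<^sup>2 / 2" using \<kappa>(3) elim(3) by (simp add: x_def)
    have "\<eta>\<^sup>2 < 1" using \<eta> by (simp add: power_less_one_iff)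
    then have "x < 1" using x_small by simp
    then have \<kappa>0: "\<kappa> \<noteq> 0" by (auto simp: x_def)
    have \<kappa>1: "norm \<kappa> < 1" using x0 by (simp add: x_def power_less_one_iff abs_square_less_1)
    define T where "T = (1 - \<eta>) / (2 * g) * real n ^ 3 * ln (real n)"
    have "0 \<le> T" unfolding T_def using \<eta> g n by simp
    then have T: "real (nat \<lfloor>T\<rfloor>) \<le> T" by simp
    have decay: "real n powr (\<eta> / 2 - 1) \<le> (1 - x) ^ nat \<lfloor>T\<rfloor>"
      using power_gap_ge[OF g \<eta> n _ _ x_small T[unfolded T_def]] x0 \<kappa>(3) by (simp add: x_def T_def)
    have "512 * C\<^sup>2 / (real n ^ 4 * x * (1 - x) ^ nat \<lfloor>T\<rfloor>)
        \<le> 512 * C\<^sup>2 / (real n ^ 4 * (c / real n ^ 3) * real n powr (\<eta> / 2 - 1))"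
      using decay \<kappa>(2) c n x0 \<open>x < 1\<close>
      by (intro divide_left_mono mult_mono mult_pos_pos) (auto simp: x_def)
    also have "\<dots> = 512 * C\<^sup>2 / c * real n powr (- \<eta> / 2)"
    proof -
      have "real n ^ 4 * (c / real n ^ 3) * real n powr (\<eta> / 2 - 1) = c * (real n powr 1 * real n powr (\<eta> / 2 - 1))"
        using n by (simp add: field_simps power4_eq_xxxx power3_eq_cube)
      also have "\<dots> = c * real n powr (\<eta> / 2)"
        by (subst powr_add[symmetric]) simp
      finally show ?thesis by (simp add: powr_minus divide_simps)
    qed
    also have "\<dots> < \<epsilon>" by fact
    finally have small': "512 * C\<^sup>2 / (real n ^ 4 * x * (1 - x) ^ nat \<lfloor>T\<rfloor>) < \<epsilon>" .
    show ?case
    proof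
      fix start assume start: "start \<in> permutations_of_set {..<n}"
      have "1 - 512 * C\<^sup>2 / (real n ^ 4 * x * (1 - x) ^ nat \<lfloor>T\<rfloor>)
          \<le> tv_dist (law_after (random_move M act) start (nat \<lfloor>T\<rfloor>)) (uniform_deck n)"
        using tv_dist_ge_if_slow_mode[OF M _ _ \<kappa>(1) \<kappa>1 \<kappa>0 start, of act "nat \<lfloor>T\<rfloor>"] elim(1) n
        by (simp add: x_def)
      then show "1 - \<epsilon> \<le> tv_dist (law_after (random_move M act) start
          (nat \<lfloor>(1 - \<eta>) / (2 * g) * real n ^ 3 * ln (real n)\<rfloor>)) (uniform_deck n)"
        using small' unfolding T_def by linarith
    qed
  qed
qed

section \<open>The moves of the three shuffles\<close>

definition up_position :: "nat \<Rightarrow> nat \<Rightarrow> nat" where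
  "up_position n i = (if i = 0 then n - 1 else i - 1)"

definition down_position :: "nat \<Rightarrow> nat \<Rightarrow> nat" where
  "down_position n i = (if i = n - 1 then 0 else i + 1)"

definition second_bottom_position :: "nat \<Rightarrow> nat \<Rightarrow> nat" where
  "second_bottom_position n i = (if i = 0 then n - 2 else if i = n - 1 then n - 1 else i - 1)"

definition swap_position :: "nat \<Rightarrow> nat" where
  "swap_position i = (if i = 0 then 1 else if i = 1 then 0 else i)"

lemma moves_positions_rotate1: "n > 0 \<Longrightarrow> moves_positions n rotate1 (up_position n)"
  by (rule moves_positionsI) (auto simp: up_position_def inj_on_def nth_rotate1)

lemma moves_positions_bottom_to_top:
  assumes "n > 0"
  shows "moves_positions n bottom_to_top (down_position n)"
proof (rule moves_positionsI)
  fix xs :: "'a list" and i assume len: "length xs = n"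
  then obtain y ys where xs: "xs = y # ys" using assms by (cases xs) auto
  show "length (bottom_to_top xs) = n" using len xs by auto
  assume "i < n"
  then show "bottom_to_top xs ! down_position n i = xs ! i"
    using len by (auto simp: xs down_position_def last_conv_nth nth_butlast simp del: last.simps butlast.simps)
qed (auto simp: down_position_def inj_on_def)

lemma moves_positions_top_to_second_bottom:
  assumes "n \<ge> 2"
  shows "moves_positions n top_to_second_bottom (second_bottom_position n)"
proof (rule moves_positionsI)
  fix xs :: "'a list" and i assume len: "length xs = n"
  then obtain x y zs where xs: "xs = x # y # zs"
    using assms by (cases xs; cases "tl xs") auto
  show "length (top_to_second_bottom xs) = n" using len xs by auto
  assume i: "i < n"
  have n: "n = Suc (Suc (length zs))" using len xs by simp
  show "top_to_second_bottom xs ! second_bottom_position n i = xs ! i"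
    using i unfolding xs n second_bottom_position_def
    by (auto simp: nth_append nth_butlast last_conv_nth nth_Cons' simp del: last.simps butlast.simps)
qed (use assms in \<open>auto simp: second_bottom_position_def inj_on_def split: if_splits\<close>)

lemma moves_positions_swap_top:
  assumes "n \<ge> 2"
  shows "moves_positions n swap_top swap_position"
proof (rule moves_positionsI)
  fix xs :: "'a list" and i assume len: "length xs = n"
  then obtain x y zs where xs: "xs = x # y # zs"
    using assms by (cases xs; cases "tl xs") auto
  show "length (swap_top xs) = n" using len xs by auto
  assume i: "i < n"
  show "swap_top xs ! swap_position i = xs ! i"
    unfolding xs swap_position_def by (auto simp: nth_Cons')
qed (use assms in \<open>auto simp: swap_position_def inj_on_def split: if_splits\<close>)

lemma moves_positions_id: "moves_positions n id id"
  by (rule moves_positionsI) auto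

lemma rudvalis_eq_random_move: "rudvalis = random_move {..<2} (\<lambda>j. [rotate1, top_to_second_bottom] ! j)"
  by (rule ext) (simp add: rudvalis_def random_move_def map_pmf_of_set numeral_2_eq_2 lessThan_Suc lessThan_empty_iff add_mset_commute)

lemma shift_or_swap_eq_random_move: "shift_or_swap = random_move {..<2} (\<lambda>j. [rotate1, swap_top] ! j)"
  by (rule ext) (simp add: shift_or_swap_def random_move_def map_pmf_of_set numeral_2_eq_2 lessThan_Suc lessThan_empty_iff add_mset_commute)

lemma symmetrized_rudvalis_eq_random_move:
  "symmetrized_rudvalis = random_move {..<4} (\<lambda>j. [rotate1, bottom_to_top, swap_top, id] ! j)"
  by (rule ext) (simp add: symmetrized_rudvalis_def random_move_def map_pmf_of_set numeral_eq_Suc lessThan_Suc lessThan_empty_iff add_mset_commute)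

section \<open>Asymptotics of perturbed eigenvalue equations\<close>

text \<open>
  Binomial coefficients are nonnegative, so the remainder at \<open>u\<close> is dominated by the one at
  \<open>norm u\<close>.
\<close>

lemma norm_one_plus_power_minus_linear:
  fixes u :: complex
  shows "norm ((1 + u) ^ k - 1 - of_nat k * u) \<le> (1 + norm u) ^ k - 1 - real k * norm u"
proof (induction k)
  case (Suc k)
  have "(1 + u) ^ Suc k - 1 - of_nat (Suc k) * u = (1 + u) * ((1 + u) ^ k - 1 - of_nat k * u) + of_nat k * u\<^sup>2"
    by (simp add: algebra_simps power2_eq_square)
  also have "norm \<dots> \<le> (1 + norm u) * ((1 + norm u) ^ k - 1 - real k * norm u) + real k * (norm u)\<^sup>2"
  proof (intro norm_triangle_le add_mono)
    show "norm ((1 + u) * ((1 + u) ^ k - 1 - of_nat k * u))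
        \<le> (1 + norm u) * ((1 + norm u) ^ k - 1 - real k * norm u)"
      unfolding norm_mult using norm_triangle_ineq[of 1 u] by (intro mult_mono Suc) auto
  qed (simp add: norm_mult norm_power)
  also have "\<dots> = (1 + norm u) ^ Suc k - 1 - real (Suc k) * norm u"
    by (simp add: algebra_simps power2_eq_square)
  finally show ?case .
qed simp

lemma norm_one_plus_power_minus_linear_le_square:
  fixes u :: complex
  assumes "real k * norm u \<le> 1"
  shows "norm ((1 + u) ^ k - 1 - of_nat k * u) \<le> (real k * norm u)\<^sup>2"
proof -
  have "(1 + norm u) ^ k \<le> exp (norm u) ^ k"
    by (intro power_mono exp_ge_add_one_self) simp
  also have "\<dots> = exp (real k * norm u)" by (simp add: exp_of_nat_mult)
  also have "\<dots> \<le> 1 + real k * norm u + (real k * norm u)\<^sup>2"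
    using assms by (intro exp_bound) auto
  finally show ?thesis using norm_one_plus_power_minus_linear[of u k] by linarith
qed

lemma norm_one_plus_power_bounds:
  fixes u :: complex
  assumes "real k * norm u \<le> 1 / 2"
  shows "1 / 2 \<le> norm (1 + u) ^ k" "norm (1 + u) ^ k \<le> 2"
proof -
  show "norm (1 + u) ^ k \<le> 2"
  proof -
    have "norm (1 + u) ^ k \<le> exp (norm u) ^ k"
      using norm_triangle_ineq[of 1 u] exp_ge_add_one_self[of "norm u"]
      by (intro power_mono) (auto intro: order_trans)
    also have "\<dots> = exp (real k * norm u)" by (simp add: exp_of_nat_mult)
    also have "\<dots> \<le> exp (1 / 2)" using assms by simp
    also have "\<dots> \<le> 2" using exp_bound[of "1 / 2"] by (simp add: power2_eq_square)
    finally show ?thesis .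
  qed
  show "1 / 2 \<le> norm (1 + u) ^ k"
  proof (cases "k = 0")
    case False
    have u: "norm u \<le> 1"
    proof -
      have "norm u \<le> real k * norm u" using False mult_right_mono[of 1 "real k" "norm u"] by simp
      then show ?thesis using assms by linarith
    qed
    have "1 / 2 \<le> 1 + real k * (- norm u)" using assms by simp
    also have "\<dots> \<le> (1 + - norm u) ^ k" using u by (intro Bernoulli_inequality) simp
    also have "\<dots> \<le> norm (1 + u) ^ k"
      using u norm_diff_ineq[of 1 u] by (intro power_mono) auto
    finally show ?thesis .
  qed simp
qed

lemma scaled_power_expansion:
  fixes z :: "nat \<Rightarrow> complex"
  assumes z: "\<And>n. norm (z n) \<le> K"
  shows "(\<lambda>n. of_nat n ^ 2 * ((1 + z n / of_nat n ^ 3) ^ (n - 2) - 1) - z n) \<longlonglongrightarrow> 0"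
proof (rule Lim_null_comparison)
  show "(\<lambda>n. (K\<^sup>2 + 2 * K) / real n) \<longlonglongrightarrow> 0" by real_asymp
  have K: "0 \<le> K" using z[of 0] norm_ge_zero order_trans by blast
  have "(\<lambda>n. K / real n ^ 2) \<longlonglongrightarrow> 0" by real_asymp
  then have "\<forall>\<^sub>F n in sequentially. K / real n ^ 2 < 1" by (rule order_tendstoD) simp
  then show "\<forall>\<^sub>F n in sequentially. norm (of_nat n ^ 2 * ((1 + z n / of_nat n ^ 3) ^ (n - 2) - 1) - z n)
      \<le> (K\<^sup>2 + 2 * K) / real n"
    using eventually_ge_at_top[of "2::nat"]
  proof eventually_elim
    case (elim n)
    let ?u = "z n / of_nat n ^ 3"
    have n: "real n \<ge> 2" using elim by simp
    have "real (n - 2) * norm ?u \<le> real n * (K / real n ^ 3)"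
      using z[of n] by (intro mult_mono) (auto simp: norm_divide norm_power divide_right_mono)
    also have "\<dots> = K / real n ^ 2" using n by (simp add: power2_eq_square power3_eq_cube)
    finally have ku: "real (n - 2) * norm ?u \<le> K / real n ^ 2" .
    have "norm ((1 + ?u) ^ (n - 2) - 1 - of_nat (n - 2) * ?u) \<le> (real (n - 2) * norm ?u)\<^sup>2"
      using ku elim by (intro norm_one_plus_power_minus_linear_le_square) linarith
    also have "\<dots> \<le> (K / real n ^ 2)\<^sup>2" using ku by (intro power_mono) auto
    finally have 1: "norm ((1 + ?u) ^ (n - 2) - 1 - of_nat (n - 2) * ?u) \<le> (K / real n ^ 2)\<^sup>2" .
    have eq: "of_nat n ^ 2 * ((1 + ?u) ^ (n - 2) - 1) - z n
        = of_nat n ^ 2 * ((1 + ?u) ^ (n - 2) - 1 - of_nat (n - 2) * ?u) - 2 * z n / of_nat n"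
      using elim(2) by (simp add: of_nat_diff power2_eq_square power3_eq_cube divide_simps) (simp add: algebra_simps)
    have "norm (of_nat n ^ 2 * ((1 + ?u) ^ (n - 2) - 1) - z n)
        \<le> real n ^ 2 * (K / real n ^ 2)\<^sup>2 + 2 * K / real n"
      unfolding eq
    proof (intro norm_triangle_le_diff add_mono)
      show "norm (of_nat n ^ 2 * ((1 + ?u) ^ (n - 2) - 1 - of_nat (n - 2) * ?u)) \<le> real n ^ 2 * (K / real n ^ 2)\<^sup>2"
        unfolding norm_mult norm_power norm_of_nat using 1 by (rule mult_left_mono) simp
      show "norm (2 * z n / of_nat n) \<le> 2 * K / real n"
        using z[of n] n by (simp add: norm_divide norm_mult divide_right_mono)
    qed
    also have "real n ^ 2 * (K / real n ^ 2)\<^sup>2 \<le> K\<^sup>2 / real n"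
    proof -
      have "real n ^ 2 * (K / real n ^ 2)\<^sup>2 = K\<^sup>2 / real n ^ 2"
        using n by (simp add: power2_eq_square)
      also have "\<dots> \<le> K\<^sup>2 / real n"
        using n by (intro divide_left_mono) (auto simp: power2_eq_square)
      finally show ?thesis .
    qed
    finally show ?case by (simp add: add_divide_distrib)
  qed
qed

text \<open>
  Testing along all sequences gives uniform convergence on the closed unit disc around \<open>z0\<close>,
  since the error attains its maximum there.  On a small circle around \<open>z0\<close> the function is then
  larger in modulus than at the centre, and the minimum modulus principle forces a zero.
\<close>

lemma zero_of_nearly_linear:
  fixes F :: "nat \<Rightarrow> complex \<Rightarrow> complex"
  assumes hol: "\<And>n. F n holomorphic_on UNIV" and a: "a \<noteq> 0"
    and lim: "\<And>z. (\<And>n. z n \<in> cball z0 1) \<Longrightarrow> (\<lambda>n. F n (z n) - a * (z n - z0)) \<longlonglongrightarrow> 0"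
    and r: "0 < r" "r \<le> 1"
  shows "\<forall>\<^sub>F n in sequentially. \<exists>z\<in>ball z0 r. F n z = 0"
proof -
  define E where "E n z = norm (F n z - a * (z - z0))" for n z
  have cont: "continuous_on UNIV (F n)" for n
    using hol by (rule holomorphic_on_imp_continuous_on)
  have "\<exists>z\<in>cball z0 1. \<forall>y\<in>cball z0 1. E n y \<le> E n z" for n
    unfolding E_def
    by (intro continuous_attains_sup continuous_intros continuous_on_subset[OF cont]) auto
  \<comment> \<open>A maximizer of the error for each \<open>n\<close>: the error along this sequence bounds it on the whole disc.\<close>
  then obtain w where w: "\<And>n. w n \<in> cball z0 1" "\<And>n y. y \<in> cball z0 1 \<Longrightarrow> E n y \<le> E n (w n)"
    by metis
  have "(\<lambda>n. E n (w n)) \<longlonglongrightarrow> 0"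
    unfolding E_def by (rule tendsto_norm_zero[OF lim]) (rule w)
  moreover have "0 < norm a * r / 2" using a r by simp
  ultimately have "\<forall>\<^sub>F n in sequentially. E n (w n) < norm a * r / 2"
    by (rule order_tendstoD)
  then show ?thesis
  proof eventually_elim
    case (elim n)
    have small: "E n y < norm a * r / 2" if "y \<in> cball z0 1" for y
      using w(2)[OF that, of n] elim by linarith
    obtain z where "z \<in> ball z0 r" "F n z = 0"
    proof (rule holomorphic_contract_to_zero)
      show "continuous_on (cball z0 r) (F n)" "F n holomorphic_on ball z0 r"
        using cont hol by (auto intro: continuous_on_subset holomorphic_on_subset)
      fix y assume y: "norm (z0 - y) = r"
      have "norm (F n z0) < norm a * r / 2" using small[of z0] by (simp add: E_def)
      moreover have "norm (F n y - a * (y - z0)) < norm a * r / 2"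
        using small[of y] y r by (simp add: E_def dist_norm)
      moreover have "norm (a * (y - z0)) = norm a * r" using y by (simp add: norm_mult norm_minus_commute)
      moreover have "norm (a * (y - z0)) \<le> norm (F n y) + norm (F n y - a * (y - z0))"
        using norm_triangle_ineq4[of "F n y" "F n y - a * (y - z0)"] by simp
      ultimately show "norm (F n z0) < norm (F n y)" by linarith
    qed (use r in auto)
    then show ?case by blast
  qed
qed

abbreviation unity_root :: "nat \<Rightarrow> complex" where
  "unity_root n \<equiv> cis (2 * pi / real n)"

lemma unity_root_power [simp]: "n > 0 \<Longrightarrow> unity_root n ^ n = 1"
  using Complex.DeMoivre[of "2 * pi / real n" n] by simp

lemma norm_unity_root_minus_1: "norm (unity_root n - 1) \<le> 7 / real n"
proof -
  have "norm (unity_root n - 1) = 2 * \<bar>sin (pi / real n)\<bar>"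
    using dist_exp_i_1[of "2 * pi / real n"] by (simp add: cis_conv_exp)
  also have "\<dots> \<le> 2 * (pi / real n)" using abs_sin_x_le_abs_x[of "pi / real n"] by simp
  also have "\<dots> \<le> 7 / real n" using pi_less_4 pi_approx(2) by (simp add: divide_right_mono)
  finally show ?thesis .
qed

lemma scaled_unity_root_limit:
  "(\<lambda>n. of_nat n * (unity_root n - 1)) \<longlonglongrightarrow> 2 * pi * \<i>"
proof -
  have "(\<lambda>n. real n * (cos (2 * pi / real n) - 1)) \<longlonglongrightarrow> 0"
    "(\<lambda>n. real n * sin (2 * pi / real n)) \<longlonglongrightarrow> 2 * pi"
    by real_asymp+
  then show ?thesis by (simp add: tendsto_complex_iff)
qed

lemma unity_root_limit: "unity_root \<longlonglongrightarrow> 1"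
proof -
  have "(\<lambda>n. 7 / real n) \<longlonglongrightarrow> 0" by real_asymp
  then have "(\<lambda>n. unity_root n - 1) \<longlonglongrightarrow> 0"
    by (rule Lim_null_comparison[rotated]) (simp add: norm_unity_root_minus_1)
  then show ?thesis by (simp add: LIM_zero_iff)
qed

lemma scaled_unity_root_square_limit:
  "(\<lambda>n. (of_nat n * (unity_root n - 1))\<^sup>2) \<longlonglongrightarrow> of_real (- 4 * pi\<^sup>2)"
  using tendsto_power[OF scaled_unity_root_limit, of 2] by (simp add: power_mult_distrib)

lemma tendsto_bounded_mult_zero:
  fixes z X :: "nat \<Rightarrow> complex"
  assumes "\<And>n. norm (z n) \<le> K" "X \<longlonglongrightarrow> 0"
  shows "(\<lambda>n. z n * X n) \<longlonglongrightarrow> 0"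
proof (rule Lim_null_comparison)
  show "(\<lambda>n. K * norm (X n)) \<longlonglongrightarrow> 0" using tendsto_norm_zero[OF assms(2)] by (rule tendsto_mult_right_zero)
  show "\<forall>\<^sub>F n in sequentially. norm (z n * X n) \<le> K * norm (X n)"
    using assms(1) by (intro always_eventually allI) (simp add: norm_mult mult_right_mono)
qed

lemma tendsto_bounded_over_power_zero:
  fixes z :: "nat \<Rightarrow> complex"
  assumes "\<And>n. norm (z n) \<le> K" "k > 0"
  shows "(\<lambda>n. z n / of_nat n ^ k) \<longlonglongrightarrow> 0"
proof -
  have "(\<lambda>n. inverse (of_nat n :: complex) ^ k) \<longlonglongrightarrow> 0 ^ k"
    by (intro tendsto_power lim_inverse_n)
  then have "(\<lambda>n. z n * inverse (of_nat n) ^ k) \<longlonglongrightarrow> 0"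
    using assms by (intro tendsto_bounded_mult_zero) (auto simp: zero_power)
  then show ?thesis by (simp add: divide_inverse power_inverse)
qed

text \<open>
  To first order, \<open>1 - (norm (1 + z / N))\<^sup>2\<close> is \<open>- 2 * Re z / N\<close>.
\<close>

lemma gap_of_perturbation:
  fixes z :: complex and N g :: real
  assumes z: "dist (- of_real g) z < r" "r \<le> 1" "r \<le> \<eta>" and g: "3 \<le> g" and N: "(g + 1)\<^sup>2 \<le> N"
  shows "g / N \<le> 1 - (norm (1 + z / of_real N))\<^sup>2"
    and "1 - (norm (1 + z / of_real N))\<^sup>2 \<le> 2 * g * (1 + \<eta>) / N"
proof -
  have N0: "N > 0" using N g by (smt (verit) zero_less_power)
  have rez: "\<bar>Re z + g\<bar> < r"
  proof -
    have "\<bar>Re (z + of_real g)\<bar> \<le> norm (z + of_real g)" by (rule abs_Re_le_cmod)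
    also have "norm (z + of_real g) = dist (- of_real g) z"
      by (simp add: dist_norm norm_minus_commute[of _ z] add.commute norm_minus_cancel[of "z + of_real g", symmetric] del: norm_minus_cancel)
    finally show ?thesis using z(1) by simp
  qed
  have "norm z \<le> norm (of_real g :: complex) + dist (- of_real g) z"
    using norm_triangle_ineq4[of "- of_real g" "- of_real g - z"] by (simp add: dist_norm)
  then have nz: "norm z \<le> g + 1" using z g by simp
  have eq: "1 - (norm (1 + z / of_real N))\<^sup>2 = (- 2 * Re z - (norm z)\<^sup>2 / N) / N"
    unfolding cmod_power2 using N0 by (simp add: power2_eq_square field_simps)
  have "(norm z)\<^sup>2 / N \<le> 1"
  proof -
    have "(norm z)\<^sup>2 \<le> (g + 1)\<^sup>2" using nz by (intro power_mono) auto
    then show ?thesis using N N0 by (simp add: divide_le_eq)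
  qed
  then have "g \<le> - 2 * Re z - (norm z)\<^sup>2 / N" using rez z g by linarith
  then show "g / N \<le> 1 - (norm (1 + z / of_real N))\<^sup>2"
    unfolding eq using N0 by (intro divide_right_mono) auto
  have "- 2 * Re z - (norm z)\<^sup>2 / N \<le> 2 * g + 2 * \<eta>"
    using rez z N0 by (smt (verit) divide_nonneg_pos zero_le_power2)
  also have "\<dots> \<le> 2 * g * (1 + \<eta>)"
    using g rez z mult_right_mono[of 1 g \<eta>] by (simp add: algebra_simps)
  finally show "1 - (norm (1 + z / of_real N))\<^sup>2 \<le> 2 * g * (1 + \<eta>) / N"
    unfolding eq using N0 by (intro divide_right_mono) auto
qed

text \<open>
  The positions 0, 1 and \<open>n - 1\<close> are the ones where the three shuffles differ from a rotation or
  where the numbering of the positions wraps around.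
\<close>

lemma sum_with_three_exceptions:
  fixes e :: "nat \<Rightarrow> real"
  assumes "n \<ge> 1" "0 \<le> a" "0 \<le> b"
    and "\<And>i. i < n \<Longrightarrow> e i \<le> a / real n"
    and "\<And>i. 2 \<le> i \<Longrightarrow> i < n - 1 \<Longrightarrow> e i \<le> b / (real n)\<^sup>2"
  shows "(\<Sum>i<n. e i) \<le> (3 * a + b) / real n"
proof -
  have "(\<Sum>i<n. e i) \<le> (\<Sum>i<n. b / (real n)\<^sup>2 + (if i \<in> {0, 1, n - 1} then a / real n else 0))"
  proof (rule sum_mono)
    fix i assume "i \<in> {..<n}"
    then show "e i \<le> b / (real n)\<^sup>2 + (if i \<in> {0, 1, n - 1} then a / real n else 0)"
      using assms(4)[of i] assms(5)[of i] assms(3)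
      by (cases "i \<in> {0, 1, n - 1}") (auto intro: add_increasing)
  qed
  also have "\<dots> = b / real n + real (card ({..<n} \<inter> {0, 1, n - 1})) * (a / real n)"
    using assms(1) by (simp add: sum.distrib sum.If_cases power2_eq_square del: insert_iff Int_insert_right)
  also have "\<dots> \<le> b / real n + 3 * (a / real n)"
  proof -
    have "card ({..<n} \<inter> {0, 1, n - 1}) \<le> card {0, 1, n - 1}" by (intro card_mono) auto
    also have "\<dots> \<le> 3" by (simp add: card_insert_if)
    finally show ?thesis using assms(2) by (intro add_left_mono mult_right_mono) auto
  qed
  finally show ?thesis by (simp add: add_divide_distrib)
qed

lemma inverse_between_half_and_two:
  fixes x :: real
  assumes "1 / 2 \<le> x \<and> x \<le> 2"
  shows "1 / 2 \<le> inverse x \<and> inverse x \<le> 2"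
  using assms by (auto simp: field_simps)

lemma pi_square_bounds: "9 \<le> pi\<^sup>2" "pi\<^sup>2 \<le> 10"
proof -
  have "3\<^sup>2 \<le> pi\<^sup>2" using pi_gt3 by (intro power_mono) auto
  then show "9 \<le> pi\<^sup>2" by simp
  have "pi \<le> 3.15" using pi_approx(2) by simp
  then have "pi\<^sup>2 \<le> 3.15\<^sup>2" by (intro power_mono) auto
  then show "pi\<^sup>2 \<le> 10" by (simp add: power2_eq_square)
qed

section \<open>The Rudvalis shuffle\<close>

text \<open>
  A card that is neither at the top nor at the bottom moves up by one under both moves, so \<open>f\<close> is
  geometric with ratio \<open>1 / \<kappa>\<close> there.  The top and the bottom card end up at one of the two lowest
  positions with equal probability, which forces \<open>f 0 = f (n - 1)\<close> and, for the mean of the two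
  lowest values, the equation for \<open>\<kappa>\<close>.  All phases are 1: the deck rotates by one in every step,
  up to one card, so the rotation is absorbed in the argument of \<open>\<kappa>\<close>.
\<close>

lemma slow_mode_rudvalis:
  fixes \<kappa> :: complex
  assumes n: "n \<ge> 3" and root: "\<kappa> ^ (n - 2) * (2 * \<kappa> - 1) = 1"
    and bounds: "\<And>i. i < n \<Longrightarrow> 1 / 2 \<le> norm \<kappa> ^ i \<and> norm \<kappa> ^ i \<le> 2"
    and near: "norm (\<kappa> - 1) \<le> 8 / real n"
  shows "slow_mode n {..<2} (\<lambda>j. [up_position n, second_bottom_position n] ! j) 24 \<kappa>"
proof -
  have \<kappa>0: "\<kappa> \<noteq> 0" using root n by (intro notI) (simp add: zero_power)
  \<comment> \<open>The value 1 at \<open>n - 1\<close> is \<open>f 0\<close>.\<close>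
  define f where "f i = (if i = n - 1 then 1 else inverse \<kappa> ^ i)" for i
  have f_bottom: "f (n - 2) = 2 * \<kappa> - 1" "f (n - 1) = 1"
    using root n \<kappa>0 by (auto simp: f_def field_simps)
  have f_shift: "f (i - 1) = \<kappa> * f i" if "0 < i" "i < n - 1" for i
    using that \<kappa>0 by (cases i) (auto simp: f_def)
  have f_top: "f 0 = 1" using n by (simp add: f_def)
  have up: "f (up_position n i) - \<kappa> * f i = (if i = 0 then 1 - \<kappa> else if i = n - 1 then \<kappa> - 1 else 0)"
    and second: "f (second_bottom_position n i) - \<kappa> * f i
      = (if i = 0 then \<kappa> - 1 else if i = n - 1 then 1 - \<kappa> else 0)" if "i < n" for i
    using that n f_shift[of i] f_bottom f_top
    by (auto simp: up_position_def second_bottom_position_def numeral_2_eq_2)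
  have drift: "(\<Sum>i<n. norm (f (\<sigma> i) - \<kappa> * f i)) \<le> 24 / real n"
    if "\<sigma> = up_position n \<or> \<sigma> = second_bottom_position n" for \<sigma>
  proof -
    have "norm (f (\<sigma> i) - \<kappa> * f i) \<le> (if i = 0 \<or> i = n - 1 then 8 / real n else 0)" if "i < n" for i
    proof -
      have "norm (f (up_position n i) - \<kappa> * f i) \<le> (if i = 0 \<or> i = n - 1 then 8 / real n else 0)"
        "norm (f (second_bottom_position n i) - \<kappa> * f i) \<le> (if i = 0 \<or> i = n - 1 then 8 / real n else 0)"
        unfolding up[OF \<open>i < n\<close>] second[OF \<open>i < n\<close>]
        using near norm_minus_commute[of 1 \<kappa>] by auto
      then show ?thesis using \<open>\<sigma> = _ \<or> \<sigma> = _\<close> by metis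
    qed
    note bound = this
    have "(\<Sum>i<n. norm (f (\<sigma> i) - \<kappa> * f i)) \<le> (3 * 8 + 0) / real n"
    proof (rule sum_with_three_exceptions)
      fix i assume "i < n"
      then show "norm (f (\<sigma> i) - \<kappa> * f i) \<le> 8 / real n"
        using bound[of i] by (auto split: if_splits)
    next
      fix i assume "2 \<le> i" "i < n - 1"
      then show "norm (f (\<sigma> i) - \<kappa> * f i) \<le> 0 / (real n)\<^sup>2"
        using bound[of i] by simp
    qed (use n in auto)
    then show ?thesis by simp
  qed
  show ?thesis
    unfolding slow_mode_def
  proof (rule exI[of _ "\<lambda>_. 1"], rule exI[of _ f], intro conjI allI impI ballI)
    fix i assume i: "i < n"
    have "(f (up_position n i) - \<kappa> * f i) + (f (second_bottom_position n i) - \<kappa> * f i) = 0"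
      using i by (simp only: up second) simp
    then show "(\<Sum>j<2. 1 * f (([up_position n, second_bottom_position n] ! j) i)) = of_nat (card {..<2::nat}) * \<kappa> * f i"
      by (simp add: numeral_2_eq_2 algebra_simps)
    have "1 / 2 \<le> inverse (norm \<kappa> ^ i) \<and> inverse (norm \<kappa> ^ i) \<le> 2"
      by (rule inverse_between_half_and_two[OF bounds[OF i]])
    then show "1 / 2 \<le> norm (f i)" "norm (f i) \<le> 2"
      by (auto simp: f_def norm_power norm_inverse power_inverse)
  next
    fix j :: nat assume "j \<in> {..<2}"
    then have "[up_position n, second_bottom_position n] ! j = up_position n
        \<or> [up_position n, second_bottom_position n] ! j = second_bottom_position n"
      by (auto simp: less_2_cases_iff)
    from drift[OF this] show "(\<Sum>i<n. norm (1 * f (([up_position n, second_bottom_position n] ! j) i) - \<kappa> * f i)) \<le> 24 / real n"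
      by simp
  qed simp
qed

text \<open>
  The eigenvalue is sought as \<open>\<kappa> = unity_root n * (1 + z / n\<^sup>3)\<close>.  Multiplied by \<open>n\<^sup>2\<close>, the
  difference of the two sides is \<open>z - (n * (unity_root n - 1))\<^sup>2 + o(1) = z + 4 * pi\<^sup>2 + o(1)\<close>.
\<close>

lemma rudvalis_root:
  assumes r: "0 < r" "r \<le> 1"
  shows "\<forall>\<^sub>F n in sequentially. \<exists>z. dist (of_real (- 4 * pi\<^sup>2)) z < r \<and>
    (1 + z / of_nat n ^ 3) ^ (n - 2) * (2 * unity_root n * (1 + z / of_nat n ^ 3) - 1) = unity_root n ^ 2"
proof -
  let ?z0 = "of_real (- 4 * pi\<^sup>2) :: complex"
  define F where "F n z = of_nat n ^ 2 * ((1 + z / of_nat n ^ 3) ^ (n - 2) *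
      (2 * unity_root n * (1 + z / of_nat n ^ 3) - 1) - unity_root n ^ 2)" for n and z :: complex
  have "\<forall>\<^sub>F n in sequentially. \<exists>z\<in>ball ?z0 r. F n z = 0"
  proof (rule zero_of_nearly_linear[where a = 1])
    show "F n holomorphic_on UNIV" for n
      unfolding F_def divide_inverse by (intro holomorphic_intros)
    fix z :: "nat \<Rightarrow> complex" assume "\<And>n. z n \<in> cball ?z0 1"
    then have z: "norm (z n) \<le> norm ?z0 + 1" for n
      using norm_triangle_ineq4[of ?z0 "?z0 - z n"] by (smt (verit) diff_diff_eq2 add_diff_cancel_left' dist_norm mem_cball)
    define P where "P n = 2 * unity_root n * (1 + z n / of_nat n ^ 3) - 1" for n
    define A where "A n = of_nat n ^ 2 * ((1 + z n / of_nat n ^ 3) ^ (n - 2) - 1) - z n" for n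
    have P: "P \<longlonglongrightarrow> 1"
      unfolding P_def
      by (rule tendsto_eq_intros unity_root_limit tendsto_bounded_over_power_zero[OF z] | simp)+
    have A: "A \<longlonglongrightarrow> 0" unfolding A_def by (rule scaled_power_expansion[OF z])
    have "(\<lambda>n. A n * P n + z n * (P n - 1) + 2 * unity_root n * (z n / of_nat n ^ 1)
        - ((of_nat n * (unity_root n - 1))\<^sup>2 - ?z0)) \<longlonglongrightarrow> 0 * 1 + 0 + 2 * 1 * 0 - (?z0 - ?z0)"
      using P by (intro tendsto_intros A tendsto_bounded_mult_zero[OF z] unity_root_limit
          tendsto_bounded_over_power_zero[OF z] scaled_unity_root_square_limit LIM_zero) auto
    moreover have "\<forall>\<^sub>F n in sequentially. A n * P n + z n * (P n - 1) + 2 * unity_root n * (z n / of_nat n ^ 1)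
        - ((of_nat n * (unity_root n - 1))\<^sup>2 - ?z0) = F n (z n) - 1 * (z n - ?z0)"
      using eventually_gt_at_top[of 0]
    proof eventually_elim
      case (elim n)
      define u where "u = z n / of_nat n ^ 3"
      define M where "M = (1 + u) ^ (n - 2)"
      have zu: "z n / of_nat n ^ 1 = of_nat n ^ 2 * u"
        using elim by (simp add: u_def power2_eq_square power3_eq_cube)
      show ?case
        unfolding A_def F_def P_def zu unfolding u_def[symmetric] unfolding M_def[symmetric]
        by (simp add: algebra_simps power2_eq_square)
    qed
    ultimately show "(\<lambda>n. F n (z n) - 1 * (z n - ?z0)) \<longlonglongrightarrow> 0"
      by (auto intro: Lim_transform_eventually)
  qed (use r in auto)
  then show ?thesis
    using eventually_gt_at_top[of 0]
  proof eventually_elim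
    case (elim n)
    then obtain z where "dist ?z0 z < r" "F n z = 0" by (auto simp: mem_ball)
    then show ?case using elim(2) unfolding F_def by (intro exI[of _ z]) auto
  qed
qed

theorem rudvalis_lower_bound:
  assumes "\<epsilon> > 0"
  shows "\<exists>\<delta> :: nat \<Rightarrow> real. \<delta> \<longlonglongrightarrow> 0 \<and> (\<forall>\<^sub>F n in sequentially. \<forall>start \<in> permutations_of_set {..<n}.
      tv_dist (law_after rudvalis start (nat \<lfloor>(1 - \<delta> n) / (2 * (4 * pi\<^sup>2)) * real n ^ 3 * ln (real n)\<rfloor>))
        (uniform_deck n) \<ge> 1 - \<epsilon>)"
  unfolding rudvalis_eq_random_move
proof (rule mixing_lower_bound[where c = "4 * pi\<^sup>2" and C = 24
      and \<sigma> = "\<lambda>n j. [up_position n, second_bottom_position n] ! j"])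
  show "\<forall>\<^sub>F n in sequentially. \<forall>j\<in>{..<2}. moves_positions n ([rotate1, top_to_second_bottom] ! j)
      ([up_position n, second_bottom_position n] ! j)"
    using eventually_ge_at_top[of 2]
    by eventually_elim
       (auto simp: less_2_cases_iff moves_positions_rotate1 moves_positions_top_to_second_bottom)
  fix \<eta> :: real assume \<eta>: "0 < \<eta>" "\<eta> < 1"
  then have "\<forall>\<^sub>F n in sequentially. \<exists>z. dist (of_real (- 4 * pi\<^sup>2)) z < \<eta> \<and>
    (1 + z / of_nat n ^ 3) ^ (n - 2) * (2 * unity_root n * (1 + z / of_nat n ^ 3) - 1) = unity_root n ^ 2"
    by (intro rudvalis_root) auto
  then show "\<forall>\<^sub>F n in sequentially. \<exists>\<kappa>. slow_mode n {..<2} (\<lambda>j. [up_position n, second_bottom_position n] ! j) 24 \<kappa> \<and>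
        4 * pi\<^sup>2 / real n ^ 3 \<le> 1 - (norm \<kappa>)\<^sup>2 \<and> 1 - (norm \<kappa>)\<^sup>2 \<le> 2 * (4 * pi\<^sup>2) * (1 + \<eta>) / real n ^ 3"
    using eventually_ge_at_top[of 100]
  proof eventually_elim
    case (elim n)
    then obtain z where z: "dist (of_real (- 4 * pi\<^sup>2)) z < \<eta>" and
      root: "(1 + z / of_nat n ^ 3) ^ (n - 2) * (2 * unity_root n * (1 + z / of_nat n ^ 3) - 1) = unity_root n ^ 2"
      by blast
    define u where "u = z / of_nat n ^ 3"
    define \<kappa> where "\<kappa> = unity_root n * (1 + u)"
    have n: "real n \<ge> 100" using elim by simp
    have norm_\<kappa>: "norm \<kappa> = norm (1 + u)" by (simp add: \<kappa>_def norm_mult)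
    have "norm z \<le> norm (of_real (- 4 * pi\<^sup>2) :: complex) + \<eta>"
      using norm_triangle_ineq4[of "of_real (- 4 * pi\<^sup>2)" "of_real (- 4 * pi\<^sup>2) - z"] z by (simp add: dist_norm)
    also have "\<dots> \<le> 41" using pi_square_bounds \<eta> by (simp add: norm_mult norm_power)
    finally have nz: "norm z \<le> 41" .
    have nu: "real n * norm u \<le> 1 / 2"
    proof -
      have "real n * norm u = norm z / real n ^ 2"
        unfolding u_def norm_divide norm_power norm_of_nat
        using n by (simp add: power2_eq_square power3_eq_cube)
      also have "\<dots> \<le> 41 / 100 ^ 2" using nz n by (intro frac_le power_mono) auto
      finally show ?thesis by simp
    qed
    have slow: "slow_mode n {..<2} (\<lambda>j. [up_position n, second_bottom_position n] ! j) 24 \<kappa>"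
    proof (rule slow_mode_rudvalis)
      have "\<kappa> ^ (n - 2) * (2 * \<kappa> - 1) = unity_root n ^ (n - 2) * ((1 + u) ^ (n - 2) * (2 * unity_root n * (1 + u) - 1))"
        by (simp only: \<kappa>_def power_mult_distrib mult_ac)
      also have "\<dots> = unity_root n ^ (n - 2 + 2)" unfolding power_add using root by (simp add: u_def)
      also have "n - 2 + 2 = n" using elim by simp
      also have "unity_root n ^ n = 1" using elim by (intro unity_root_power) simp
      finally show "\<kappa> ^ (n - 2) * (2 * \<kappa> - 1) = 1" .
      have "\<kappa> - 1 = unity_root n * u + (unity_root n - 1)" by (simp add: \<kappa>_def algebra_simps)
      also have "norm \<dots> \<le> 1 / real n + 7 / real n"
        using nu n by (intro norm_triangle_le add_mono norm_unity_root_minus_1) (simp add: norm_mult field_simps)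
      finally show "norm (\<kappa> - 1) \<le> 8 / real n" by simp
      fix i assume "i < n"
      then have "real i * norm u \<le> 1 / 2" using nu mult_right_mono[of "real i" "real n" "norm u"] by simp
      then show "1 / 2 \<le> norm \<kappa> ^ i \<and> norm \<kappa> ^ i \<le> 2"
        unfolding norm_\<kappa> using norm_one_plus_power_bounds by blast
    qed (use elim in simp)
    have "(4 * pi\<^sup>2 + 1)\<^sup>2 \<le> 41\<^sup>2" using pi_square_bounds by (intro power_mono) auto
    also have "\<dots> \<le> (100 :: real) ^ 3" by simp
    also have "\<dots> \<le> real n ^ 3" using n by (intro power_mono) auto
    finally have N: "(4 * pi\<^sup>2 + 1)\<^sup>2 \<le> real n ^ 3" .
    have "4 * pi\<^sup>2 / real n ^ 3 \<le> 1 - (norm \<kappa>)\<^sup>2 \<and> 1 - (norm \<kappa>)\<^sup>2 \<le> 2 * (4 * pi\<^sup>2) * (1 + \<eta>) / real n ^ 3"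
      using gap_of_perturbation[of "4 * pi\<^sup>2" z \<eta> \<eta> "real n ^ 3"] z \<eta> N pi_square_bounds
      by (simp add: norm_\<kappa> u_def)
    with slow show ?case by blast
  qed
qed (use assms in \<open>auto simp: lessThan_empty_iff\<close>)

section \<open>The shift-or-swap shuffle\<close>

text \<open>
  The rotation carries the phase \<open>w\<close>, the swap carries none.  From position 2 on a card is
  rotated or left alone, so \<open>f\<close> is geometric with ratio \<open>w / (2 * \<kappa> - 1)\<close> from position 1 on.  The
  equation at position 1 determines \<open>f 0\<close>, and the equation at position 0 becomes the condition on
  \<open>\<kappa>\<close>.
\<close>

lemma slow_mode_shift_or_swap:
  fixes \<kappa> w :: complex
  assumes n: "n \<ge> 18" and w: "w ^ n = 1" "norm w = 1" "norm (w - 1) \<le> 7 / real n"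
    and root: "w * (4 * \<kappa>\<^sup>2 - 1 - w) * (2 * \<kappa> - 1) ^ (n - 2) = 1 + w"
    and bounds: "\<And>i. i < n \<Longrightarrow> 1 / 2 \<le> norm (2 * \<kappa> - 1) ^ i \<and> norm (2 * \<kappa> - 1) ^ i \<le> 2"
    and near: "norm (\<kappa> - 1) \<le> 1 / real n ^ 2"
  shows "slow_mode n {..<2} (\<lambda>j. [up_position n, swap_position] ! j) 59 \<kappa>"
proof -
  let ?b = "2 * \<kappa> - 1"
  have rn: "real n \<ge> 18" using n by simp
  have near1: "norm (\<kappa> - 1) \<le> 1 / real n"
  proof -
    have "1 / real n ^ 2 \<le> 1 / real n" using rn by (intro divide_left_mono) (auto simp: power2_eq_square)
    then show ?thesis using near by linarith
  qed
  have inv_n: "7 / real n \<le> 1 / 2" "1 / real n \<le> 1 / 2" "9 / real n \<le> 1 / 2" using rn by (auto simp: field_simps)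
  have b0: "?b \<noteq> 0" using bounds[of 1] n by auto
  have w1: "1 \<le> norm (1 + w)"
  proof -
    have "norm (2 - (1 - w)) \<ge> norm (2 :: complex) - norm (1 - w)" by (rule norm_triangle_ineq2)
    then show ?thesis using w(3) inv_n norm_minus_commute[of 1 w] by simp
  qed
  then have w0: "1 + w \<noteq> 0" "w \<noteq> 0" using w(2) by auto
  define q where "q = w / ?b"
  \<comment> \<open>Normalized by \<open>f 1 = 1\<close>.\<close>
  define f where "f i = (if i = 0 then 2 * \<kappa> / (1 + w) else q ^ (i - 1))" for i
  have f_1: "f 1 = 1" by (simp add: f_def)
  have "f 0 = 2 * \<kappa> / (1 + w)" by (simp add: f_def)
  then have f_0: "(1 + w) * f 0 = 2 * \<kappa>"
    by (simp only: times_divide_eq_right nonzero_mult_div_cancel_left[OF w0(1)])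
  have f_shift: "w * f (i - 1) = ?b * f i" if "2 \<le> i" for i
  proof -
    have "f i = q * f (i - 1)" using that by (cases i; cases "i - 1") (auto simp: f_def)
    moreover have "?b * q = w" unfolding q_def by (simp only: times_divide_eq_right nonzero_mult_div_cancel_left[OF b0])
    ultimately show ?thesis by (metis mult.assoc)
  qed
  have f_bottom: "w * f (n - 1) = 2 * \<kappa> * f 0 - 1"
  proof -
    have "n - 2 + 2 = n" using n by simp
    then have "w ^ (n - 2) * w ^ 2 = 1" using w(1) by (metis power_add)
    then have bottom: "f (n - 1) * ?b ^ (n - 2) * w ^ 2 = 1"
      using n b0 by (simp add: f_def q_def power_divide numeral_2_eq_2)
    have "(1 + w) * (2 * \<kappa> * f 0 - 1) = 2 * \<kappa> * ((1 + w) * f 0) - (1 + w)"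
      by (simp add: algebra_simps)
    also have "\<dots> = 4 * \<kappa>\<^sup>2 - 1 - w" unfolding f_0 by (simp add: power2_eq_square)
    finally have "(1 + w) * (2 * \<kappa> * f 0 - 1) = 4 * \<kappa>\<^sup>2 - 1 - w" .
    then have "w * ((1 + w) * (2 * \<kappa> * f 0 - 1)) * ?b ^ (n - 2) = 1 + w"
      using root by simp
    then have "(1 + w) * (w * (2 * \<kappa> * f 0 - 1) * ?b ^ (n - 2)) = (1 + w) * 1"
      by (simp only: mult_ac mult_1_left mult_1_right)
    then have "w * (2 * \<kappa> * f 0 - 1) * ?b ^ (n - 2) = 1"
      using w0 by (metis mult_cancel_left)
    then have "(?b ^ (n - 2) * w) * (w * f (n - 1)) = (?b ^ (n - 2) * w) * (2 * \<kappa> * f 0 - 1)"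
      using bottom by (simp add: power2_eq_square mult_ac)
    moreover have "?b ^ (n - 2) * w \<noteq> 0" using b0 w0 by simp
    ultimately show ?thesis by (metis mult_cancel_left)
  qed
  have f0_near: "norm (f 0 - 1) \<le> 9 / real n"
  proof -
    have eq: "(1 + w) * (f 0 - 1) = 2 * (\<kappa> - 1) - (w - 1)"
      using f_0 by (simp add: right_diff_distrib)
    have "norm (f 0 - 1) \<le> norm (1 + w) * norm (f 0 - 1)"
      using mult_right_mono[OF w1, of "norm (f 0 - 1)"] by simp
    also have "\<dots> = norm (2 * (\<kappa> - 1) - (w - 1))" by (simp add: eq flip: norm_mult)
    also have "\<dots> \<le> 2 * (1 / real n) + 7 / real n"
      using near1 w(3) norm_triangle_ineq4[of "2 * (\<kappa> - 1)" "w - 1"] norm_mult[of 2 "\<kappa> - 1"] by simp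
    finally show ?thesis by simp
  qed
  have norm_\<kappa>: "norm \<kappa> \<le> 2"
    using norm_triangle_ineq[of "\<kappa> - 1" 1] near1 inv_n by simp
  have f_bounds: "1 / 2 \<le> norm (f i) \<and> norm (f i) \<le> 2" if "i < n" for i
  proof (cases "i = 0")
    case True
    then show ?thesis
      using f0_near inv_n norm_triangle_ineq[of "f 0 - 1" 1] norm_triangle_ineq4[of "f 0" "f 0 - 1"]
      by simp
  next
    case False
    then have "norm (f i) = inverse (norm ?b ^ (i - 1))"
      using w(2) by (simp add: f_def q_def norm_power norm_divide power_divide inverse_eq_divide)
    then show ?thesis using inverse_between_half_and_two[OF bounds[of "i - 1"]] that by simp
  qed
  have ends: "norm (\<kappa> * f 0 - 1) \<le> 19 / real n"
  proof -
    have "norm \<kappa> * norm (f 0 - 1) \<le> 2 * (9 / real n)"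
      using norm_\<kappa> f0_near by (intro mult_mono) (auto simp del: mult_le_cancel_left_pos times_divide_eq_right)
    moreover have eq: "\<kappa> * f 0 - 1 = \<kappa> * (f 0 - 1) + (\<kappa> - 1)" by (simp add: algebra_simps)
    ultimately have "norm (\<kappa> * f 0 - 1) \<le> 2 * (9 / real n) + 1 / real n"
      unfolding eq using near1 norm_triangle_ineq[of "\<kappa> * (f 0 - 1)" "\<kappa> - 1"] norm_mult[of \<kappa> "f 0 - 1"] by linarith
    then show ?thesis by simp
  qed
  have bulk: "norm ((\<kappa> - 1) * f i) \<le> 2 / (real n)\<^sup>2" if "i < n" for i
    using f_bounds[OF that] near mult_mono[of "norm (\<kappa> - 1)" "1 / (real n)\<^sup>2" "norm (f i)" 2]
    by (simp add: norm_mult)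
  have small: "2 / (real n)\<^sup>2 \<le> 19 / real n"
    using rn by (simp add: power2_eq_square field_simps)
  have up: "w * f (up_position n i) - \<kappa> * f i
      = (if i = 0 then \<kappa> * f 0 - 1 else if i = 1 then w * f 0 - \<kappa> else (\<kappa> - 1) * f i)" for i
  proof -
    consider "i = 0" | "i = 1" | "2 \<le> i" by linarith
    then show ?thesis
    proof cases
      case 3
      then show ?thesis using f_shift[of i] by (simp add: up_position_def algebra_simps)
    qed (use f_bottom f_1 in \<open>simp_all add: up_position_def\<close>)
  qed
  have swap: "f (swap_position i) - \<kappa> * f i
      = (if i = 0 then 1 - \<kappa> * f 0 else if i = 1 then f 0 - \<kappa> else - ((\<kappa> - 1) * f i))" for i
    using f_1 by (simp add: swap_position_def algebra_simps)
  have drift_up: "(\<Sum>i<n. norm (w * f (up_position n i) - \<kappa> * f i)) \<le> (3 * 19 + 2) / real n"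
  proof (rule sum_with_three_exceptions)
    have "w * f 0 - \<kappa> = w * (f 0 - 1) + ((w - 1) - (\<kappa> - 1))" by (simp add: algebra_simps)
    also have "norm \<dots> \<le> 9 / real n + (7 / real n + 1 / real n)"
      using near1 w f0_near norm_mult[of w "f 0 - 1"] norm_triangle_ineq4[of "w - 1" "\<kappa> - 1"]
        norm_triangle_ineq[of "w * (f 0 - 1)" "(w - 1) - (\<kappa> - 1)"] by simp
    finally have second: "norm (w * f 0 - \<kappa>) \<le> 19 / real n" using rn by (simp add: field_simps)
    fix i assume "i < n"
    then show "norm (w * f (up_position n i) - \<kappa> * f i) \<le> 19 / real n"
      unfolding up using ends second order_trans[OF bulk small] by auto
  next
    fix i assume "2 \<le> i" "i < n - 1"
    then show "norm (w * f (up_position n i) - \<kappa> * f i) \<le> 2 / (real n)\<^sup>2"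
      unfolding up using bulk[of i] by auto
  qed (use n in auto)
  have drift_swap: "(\<Sum>i<n. norm (f (swap_position i) - \<kappa> * f i)) \<le> (3 * 19 + 2) / real n"
  proof (rule sum_with_three_exceptions)
    have "f 0 - \<kappa> = (f 0 - 1) - (\<kappa> - 1)" by simp
    also have "norm \<dots> \<le> 9 / real n + 1 / real n"
      using near1 f0_near norm_triangle_ineq4[of "f 0 - 1" "\<kappa> - 1"] by simp
    finally have second: "norm (f 0 - \<kappa>) \<le> 19 / real n" using rn by (simp add: field_simps)
    fix i assume "i < n"
    then show "norm (f (swap_position i) - \<kappa> * f i) \<le> 19 / real n"
      unfolding swap using ends second order_trans[OF bulk small] norm_minus_commute[of 1 "\<kappa> * f 0"]
      by (auto simp only: norm_minus_cancel split: if_splits)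
  next
    fix i assume "2 \<le> i" "i < n - 1"
    then show "norm (f (swap_position i) - \<kappa> * f i) \<le> 2 / (real n)\<^sup>2"
      unfolding swap using bulk[of i] by (auto simp only: norm_minus_cancel split: if_splits)
  qed (use n in auto)
  show ?thesis
    unfolding slow_mode_def
  proof (rule exI[of _ "\<lambda>j. [w, 1] ! j"], rule exI[of _ f], intro conjI allI impI ballI)
    fix i assume i: "i < n"
    have "(w * f (up_position n i) - \<kappa> * f i) + (f (swap_position i) - \<kappa> * f i) = 0"
    proof -
      have "w * f 0 - \<kappa> + (f 0 - \<kappa>) = 0" using f_0 by (simp add: algebra_simps)
      then show ?thesis unfolding up swap by auto
    qed
    then show "(\<Sum>j<2. [w, 1] ! j * f (([up_position n, swap_position] ! j) i)) = of_nat (card {..<2::nat}) * \<kappa> * f i"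
      by (simp add: numeral_2_eq_2 algebra_simps)
    show "1 / 2 \<le> norm (f i)" "norm (f i) \<le> 2" using f_bounds[OF i] by auto
  next
    fix j :: nat assume "j \<in> {..<2}"
    then have "j = 0 \<or> j = 1" by (auto simp: less_2_cases_iff)
    then show "norm ([w, 1] ! j) = 1"
      "(\<Sum>i<n. norm ([w, 1] ! j * f (([up_position n, swap_position] ! j) i) - \<kappa> * f i)) \<le> 59 / real n"
      using drift_up drift_swap w(2) by auto
  qed
qed

text \<open>
  With \<open>\<kappa> = 1 + z / n\<^sup>3\<close>, the difference of the two sides multiplied by \<open>n\<^sup>2\<close> is
  \<open>4 * z - (n * (unity_root n - 1))\<^sup>2 + o(1) = 4 * (z + pi\<^sup>2) + o(1)\<close>.
\<close>

lemma shift_or_swap_root: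
  assumes r: "0 < r" "r \<le> 1"
  shows "\<forall>\<^sub>F n in sequentially. \<exists>z. dist (of_real (- (pi\<^sup>2))) z < r \<and>
    unity_root n * (4 * (1 + z / of_nat n ^ 3)\<^sup>2 - 1 - unity_root n) * (2 * (1 + z / of_nat n ^ 3) - 1) ^ (n - 2)
      = 1 + unity_root n"
proof -
  let ?z0 = "of_real (- (pi\<^sup>2)) :: complex"
  define F where "F n z = of_nat n ^ 2 * (unity_root n * (4 * (1 + z / of_nat n ^ 3)\<^sup>2 - 1 - unity_root n) *
      (2 * (1 + z / of_nat n ^ 3) - 1) ^ (n - 2) - (1 + unity_root n))" for n and z :: complex
  have "\<forall>\<^sub>F n in sequentially. \<exists>z\<in>ball ?z0 r. F n z = 0"
  proof (rule zero_of_nearly_linear[where a = 4])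
    show "F n holomorphic_on UNIV" for n
      unfolding F_def divide_inverse by (intro holomorphic_intros)
    fix z :: "nat \<Rightarrow> complex" assume "\<And>n. z n \<in> cball ?z0 1"
    then have z: "norm (z n) \<le> norm ?z0 + 1" for n
      using norm_triangle_ineq4[of ?z0 "?z0 - z n"] by (smt (verit) diff_diff_eq2 add_diff_cancel_left' dist_norm mem_cball)
    have z2: "norm (2 * z n) \<le> 2 * (norm ?z0 + 1)" for n
      using z[of n] by (simp add: norm_mult)
    define P where "P n = unity_root n * (4 * (1 + z n / of_nat n ^ 3)\<^sup>2 - 1 - unity_root n)" for n
    define A where "A n = of_nat n ^ 2 * ((1 + 2 * z n / of_nat n ^ 3) ^ (n - 2) - 1) - 2 * z n" for n
    have P: "P \<longlonglongrightarrow> 2"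
      unfolding P_def
      by (rule tendsto_eq_intros unity_root_limit tendsto_bounded_over_power_zero[OF z] | simp)+
    then have P0: "(\<lambda>n. P n - 2) \<longlonglongrightarrow> 0" by (rule LIM_zero)
    have A: "A \<longlonglongrightarrow> 0" unfolding A_def by (rule scaled_power_expansion[OF z2])
    have W0: "(\<lambda>n. unity_root n * (2 + z n / of_nat n ^ 3) - 2) \<longlonglongrightarrow> 0"
      by (rule tendsto_eq_intros unity_root_limit tendsto_bounded_over_power_zero[OF z] | simp)+
    have "(\<lambda>n. A n * P n + 2 * (z n * (P n - 2))
        + 4 * (unity_root n * (2 + z n / of_nat n ^ 3)) * (z n / of_nat n ^ 1)
        - ((of_nat n * (unity_root n - 1))\<^sup>2 - of_real (- 4 * pi\<^sup>2))) \<longlonglongrightarrow> 0 * 2 + 2 * 0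
          + 4 * 2 * 0 - (of_real (- 4 * pi\<^sup>2) - of_real (- 4 * pi\<^sup>2))"
      by (intro tendsto_intros A P P0 tendsto_bounded_mult_zero[OF z] LIM_zero_cancel[OF W0]
          tendsto_bounded_over_power_zero[OF z] scaled_unity_root_square_limit) auto
    moreover have "\<forall>\<^sub>F n in sequentially. A n * P n + 2 * (z n * (P n - 2))
        + 4 * (unity_root n * (2 + z n / of_nat n ^ 3)) * (z n / of_nat n ^ 1)
        - ((of_nat n * (unity_root n - 1))\<^sup>2 - of_real (- 4 * pi\<^sup>2)) = F n (z n) - 4 * (z n - ?z0)"
      using eventually_gt_at_top[of 0]
    proof eventually_elim
      case (elim n)
      define u where "u = z n / of_nat n ^ 3"
      define M where "M = (1 + 2 * u) ^ (n - 2)"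
      have zu2: "2 * z n / of_nat n ^ 3 = 2 * u" by (simp add: u_def)
      have M: "(2 * (1 + u) - 1) ^ (n - 2) = M" by (simp add: M_def)
      have zu: "z n / of_nat n ^ 1 = of_nat n ^ 2 * u"
        using elim by (simp add: u_def power2_eq_square power3_eq_cube)
      show ?case
        unfolding A_def F_def P_def zu zu2 unfolding u_def[symmetric] unfolding M M_def[symmetric]
        by (simp add: algebra_simps power2_eq_square)
    qed
    ultimately show "(\<lambda>n. F n (z n) - 4 * (z n - ?z0)) \<longlonglongrightarrow> 0"
      by (auto intro: Lim_transform_eventually)
  qed (use r in auto)
  then show ?thesis
    using eventually_gt_at_top[of 0]
  proof eventually_elim
    case (elim n)
    then obtain z where "dist ?z0 z < r" "F n z = 0" by (auto simp: mem_ball)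
    then show ?case using elim(2) unfolding F_def by (intro exI[of _ z]) auto
  qed
qed

theorem shift_or_swap_lower_bound:
  assumes "\<epsilon> > 0"
  shows "\<exists>\<delta> :: nat \<Rightarrow> real. \<delta> \<longlonglongrightarrow> 0 \<and> (\<forall>\<^sub>F n in sequentially. \<forall>start \<in> permutations_of_set {..<n}.
      tv_dist (law_after shift_or_swap start (nat \<lfloor>(1 - \<delta> n) / (2 * pi\<^sup>2) * real n ^ 3 * ln (real n)\<rfloor>))
        (uniform_deck n) \<ge> 1 - \<epsilon>)"
  unfolding shift_or_swap_eq_random_move
proof (rule mixing_lower_bound[where c = "pi\<^sup>2" and C = 59
      and \<sigma> = "\<lambda>n j. [up_position n, swap_position] ! j"])
  show "\<forall>\<^sub>F n in sequentially. \<forall>j\<in>{..<2}. moves_positions n ([rotate1, swap_top] ! j)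
      ([up_position n, swap_position] ! j)"
    using eventually_ge_at_top[of 2]
    by eventually_elim (auto simp: less_2_cases_iff moves_positions_rotate1 moves_positions_swap_top)
  fix \<eta> :: real assume \<eta>: "0 < \<eta>" "\<eta> < 1"
  then have "\<forall>\<^sub>F n in sequentially. \<exists>z. dist (of_real (- (pi\<^sup>2))) z < \<eta> \<and>
    unity_root n * (4 * (1 + z / of_nat n ^ 3)\<^sup>2 - 1 - unity_root n) * (2 * (1 + z / of_nat n ^ 3) - 1) ^ (n - 2)
      = 1 + unity_root n"
    by (intro shift_or_swap_root) auto
  then show "\<forall>\<^sub>F n in sequentially. \<exists>\<kappa>. slow_mode n {..<2} (\<lambda>j. [up_position n, swap_position] ! j) 59 \<kappa> \<and>
        pi\<^sup>2 / real n ^ 3 \<le> 1 - (norm \<kappa>)\<^sup>2 \<and> 1 - (norm \<kappa>)\<^sup>2 \<le> 2 * pi\<^sup>2 * (1 + \<eta>) / real n ^ 3"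
    using eventually_ge_at_top[of 100]
  proof eventually_elim
    case (elim n)
    then obtain z where z: "dist (of_real (- (pi\<^sup>2))) z < \<eta>" and
      root: "unity_root n * (4 * (1 + z / of_nat n ^ 3)\<^sup>2 - 1 - unity_root n) * (2 * (1 + z / of_nat n ^ 3) - 1) ^ (n - 2)
        = 1 + unity_root n"
      by blast
    define u where "u = z / of_nat n ^ 3"
    have n: "real n \<ge> 100" using elim by simp
    have "norm z \<le> norm (of_real (- (pi\<^sup>2)) :: complex) + \<eta>"
      using norm_triangle_ineq4[of "of_real (- (pi\<^sup>2))" "of_real (- (pi\<^sup>2)) - z"] z by (simp add: dist_norm)
    also have "\<dots> \<le> 11" using pi_square_bounds \<eta> by (simp add: norm_mult norm_power)
    finally have nz: "norm z \<le> 11" .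
    have nu: "real n * norm (2 * u) \<le> 1 / 2"
    proof -
      have "real n * norm (2 * u) = 2 * norm z / real n ^ 2"
        using n by (simp add: u_def norm_divide norm_mult norm_power power2_eq_square power3_eq_cube)
      also have "\<dots> \<le> 22 / 100 ^ 2" using nz n by (intro frac_le power_mono) auto
      finally show ?thesis by simp
    qed
    have slow: "slow_mode n {..<2} (\<lambda>j. [up_position n, swap_position] ! j) 59 (1 + u)"
    proof (rule slow_mode_shift_or_swap)
      show "unity_root n * (4 * (1 + u)\<^sup>2 - 1 - unity_root n) * (2 * (1 + u) - 1) ^ (n - 2) = 1 + unity_root n"
        using root by (simp add: u_def)
      have "norm u = (norm z / real n) / real n ^ 2"
        unfolding u_def norm_divide norm_power norm_of_nat
        by (simp add: power2_eq_square power3_eq_cube)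
      also have "\<dots> \<le> 1 / real n ^ 2" using nz n by (intro divide_right_mono) auto
      finally show "norm (1 + u - 1) \<le> 1 / real n ^ 2" by simp
      fix i assume "i < n"
      then have "real i * norm (2 * u) \<le> 1 / 2"
        using nu mult_right_mono[of "real i" "real n" "norm (2 * u)"] by simp
      then have "1 / 2 \<le> norm (1 + 2 * u) ^ i \<and> norm (1 + 2 * u) ^ i \<le> 2"
        using norm_one_plus_power_bounds by blast
      then show "1 / 2 \<le> norm (2 * (1 + u) - 1) ^ i \<and> norm (2 * (1 + u) - 1) ^ i \<le> 2"
        by simp
    qed (use elim norm_unity_root_minus_1 in auto)
    have "(pi\<^sup>2 + 1)\<^sup>2 \<le> 11\<^sup>2" using pi_square_bounds by (intro power_mono) auto
    also have "\<dots> \<le> (100 :: real) ^ 3" by simp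
    also have "\<dots> \<le> real n ^ 3" using n by (intro power_mono) auto
    finally have N: "(pi\<^sup>2 + 1)\<^sup>2 \<le> real n ^ 3" .
    have "pi\<^sup>2 / real n ^ 3 \<le> 1 - (norm (1 + u))\<^sup>2 \<and> 1 - (norm (1 + u))\<^sup>2 \<le> 2 * pi\<^sup>2 * (1 + \<eta>) / real n ^ 3"
      using gap_of_perturbation[of "pi\<^sup>2" z \<eta> \<eta> "real n ^ 3"] z \<eta> N pi_square_bounds
      by (simp add: u_def)
    with slow show ?case by blast
  qed
qed (use assms in \<open>auto simp: lessThan_empty_iff\<close>)

section \<open>The symmetrized Rudvalis shuffle\<close>

text \<open>
  The algebra behind the matching at the cut, with \<open>C\<close>, \<open>S\<close> for the cosine and sine of half the
  total phase, \<open>k\<close>, \<open>H\<close> for the cosine and tangent of half a step of the wave, and \<open>c\<close>, \<open>T\<close> for those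
  of half a step of the rotation.  The choice of \<open>\<beta>\<close> makes the real and the imaginary part of the
  condition equivalent, so that a single equation remains.
\<close>

lemma tilted_wave_matching:
  fixes c k C S H T \<beta> :: real
  assumes "c\<^sup>2 * (1 + T\<^sup>2) = 1" "\<beta> * T = H" "T \<noteq> 0" and root: "2 * S * H = C * (T\<^sup>2 + H\<^sup>2)"
  shows "c * (c * (k * (C + S * H)) + \<beta> * ((c * T) * (k * (S - C * H)))) = k * C"
    and "c * ((c * T) * (k * (C + S * H)) - \<beta> * (c * (k * (S - C * H)))) = \<beta> * (k * S)"
proof -
  have "c * (c * (k * (C + S * H)) + \<beta> * ((c * T) * (k * (S - C * H))))
      = c\<^sup>2 * k * (C + S * H + (\<beta> * T) * (S - C * H))"
    by (simp add: algebra_simps power2_eq_square)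
  also have "\<dots> = c\<^sup>2 * k * (C - C * H\<^sup>2 + 2 * S * H)"
    by (simp only: assms(2)) (simp add: algebra_simps power2_eq_square)
  also have "\<dots> = (c\<^sup>2 * (1 + T\<^sup>2)) * (k * C)"
    unfolding root by (simp add: algebra_simps)
  finally show "c * (c * (k * (C + S * H)) + \<beta> * ((c * T) * (k * (S - C * H)))) = k * C"
    by (simp add: assms(1))
  have "T * (c * ((c * T) * (k * (C + S * H)) - \<beta> * (c * (k * (S - C * H)))))
      = c\<^sup>2 * k * (T\<^sup>2 * (C + S * H) - (\<beta> * T) * (S - C * H))"
    by (simp add: algebra_simps power2_eq_square)
  also have "\<dots> = c\<^sup>2 * k * (C * (T\<^sup>2 + H\<^sup>2) + T\<^sup>2 * (S * H) - S * H)"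
    by (simp only: assms(2)) (simp add: algebra_simps power2_eq_square)
  also have "\<dots> = (c\<^sup>2 * (1 + T\<^sup>2)) * (k * (S * H))"
    unfolding root[symmetric] by (simp add: algebra_simps)
  also have "\<dots> = T * (\<beta> * (k * S))"
    by (simp add: assms(1) assms(2)[symmetric])
  finally show "c * ((c * T) * (k * (C + S * H)) - \<beta> * (c * (k * (S - C * H)))) = \<beta> * (k * S)"
    using assms(3) by simp
qed

text \<open>
  In the coordinate \<open>x\<close>, measured from the middle of the cycle, reflection of the deck combined
  with complex conjugation is a symmetry of the eigenvalue problem.  Up to real
  factors, these are the combinations of \<open>exp (\<i> * \<phi> * x)\<close> and \<open>exp (- \<i> * \<phi> * x)\<close> that have
  this symmetry and do not vanish at 0.
\<close>

definition tilted_wave :: "real \<Rightarrow> real \<Rightarrow> real \<Rightarrow> complex" where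
  "tilted_wave \<phi> \<beta> x = Complex (cos (\<phi> * x)) (\<beta> * sin (\<phi> * x))"

lemma tilted_wave_minus: "tilted_wave \<phi> \<beta> (- x) = cnj (tilted_wave \<phi> \<beta> x)"
  by (simp add: tilted_wave_def complex_eq_iff)

text \<open>
  Where only rotations act, the mode divided by the phase of the rotation satisfies the equation of
  a lazy walk on the integers, whose eigenvalues are squared cosines.
\<close>

lemma tilted_wave_recurrence:
  "tilted_wave \<phi> \<beta> (x - 1) + tilted_wave \<phi> \<beta> (x + 1) + 2 * tilted_wave \<phi> \<beta> x
    = 4 * of_real ((cos (\<phi> / 2))\<^sup>2) * tilted_wave \<phi> \<beta> x"
proof -
  have "4 * (cos (\<phi> / 2))\<^sup>2 = 2 + 2 * cos \<phi>"
    using cos_double_cos[of "\<phi> / 2"] by simp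
  then have eq: "4 * of_real ((cos (\<phi> / 2))\<^sup>2) = (of_real (2 + 2 * cos \<phi>) :: complex)"
    by (metis of_real_mult of_real_numeral)
  show ?thesis
    unfolding eq by (simp add: tilted_wave_def complex_eq_iff algebra_simps cos_add cos_diff sin_add sin_diff)
qed

text \<open>
  The cosine is stationary at 0, so within distance \<open>L\<close> its increments are of second order in \<open>\<phi>\<close>;
  those of the imaginary part are of first order, but carry the factor \<open>\<beta>\<close>.
\<close>

lemma tilted_wave_step:
  assumes "\<bar>x + 1 / 2\<bar> \<le> L" "0 \<le> \<phi>" "0 \<le> \<beta>"
  shows "norm (tilted_wave \<phi> \<beta> (x + 1) - tilted_wave \<phi> \<beta> x) \<le> L * \<phi>\<^sup>2 + \<beta> * \<phi>"
proof -
  have "\<bar>cos (\<phi> * (x + 1)) - cos (\<phi> * x)\<bar> = 2 * \<bar>sin (\<phi> * (x + 1 / 2))\<bar> * \<bar>sin (\<phi> / 2)\<bar>"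
    unfolding cos_diff_cos by (simp add: abs_mult algebra_simps add_divide_distrib)
  also have "\<dots> \<le> 2 * (\<phi> * L) * (\<phi> / 2)"
  proof (intro mult_mono)
    have "\<bar>sin (\<phi> * (x + 1 / 2))\<bar> \<le> \<phi> * \<bar>x + 1 / 2\<bar>"
      using abs_sin_x_le_abs_x[of "\<phi> * (x + 1 / 2)"] assms(2) by (simp add: abs_mult)
    also have "\<dots> \<le> \<phi> * L" using assms by (intro mult_left_mono) auto
    finally show "\<bar>sin (\<phi> * (x + 1 / 2))\<bar> \<le> \<phi> * L" .
    show "\<bar>sin (\<phi> / 2)\<bar> \<le> \<phi> / 2" using abs_sin_x_le_abs_x[of "\<phi> / 2"] assms(2) by simp
  qed (use assms in auto)
  finally have re: "\<bar>cos (\<phi> * (x + 1)) - cos (\<phi> * x)\<bar> \<le> L * \<phi>\<^sup>2"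
    by (simp add: power2_eq_square mult_ac)
  have "\<bar>sin (\<phi> * (x + 1)) - sin (\<phi> * x)\<bar> = 2 * \<bar>sin (\<phi> / 2)\<bar> * \<bar>cos ((\<phi> * (x + 1) + \<phi> * x) / 2)\<bar>"
    unfolding sin_diff_sin by (simp add: abs_mult algebra_simps)
  also have "\<dots> \<le> 2 * (\<phi> / 2) * 1"
    using abs_sin_x_le_abs_x[of "\<phi> / 2"] assms(2) by (intro mult_mono) auto
  finally have "\<beta> * \<bar>sin (\<phi> * (x + 1)) - sin (\<phi> * x)\<bar> \<le> \<beta> * \<phi>"
    using assms(3) by (intro mult_left_mono) auto
  then have im: "\<bar>\<beta> * sin (\<phi> * (x + 1)) - \<beta> * sin (\<phi> * x)\<bar> \<le> \<beta> * \<phi>"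
    using assms(3) by (simp add: abs_mult flip: right_diff_distrib)
  show ?thesis
    using cmod_le[of "tilted_wave \<phi> \<beta> (x + 1) - tilted_wave \<phi> \<beta> x"] re im
    by (simp add: tilted_wave_def)
qed

text \<open>
  The swap exchanges the two ends of the interval on which the recurrence holds.  This is the
  condition that the wave, continued one step beyond its right end (first term on the right), must
  satisfy there; the one at the left end is its reflection.
\<close>

lemma tilted_wave_matching_at_cut:
  fixes t h :: real
  defines "\<beta> \<equiv> tan h / tan t"
  assumes t: "0 < t" "t < pi / 2" and h: "cos h \<noteq> 0"
    and root: "2 * sin N * tan h = cos N * ((tan t)\<^sup>2 + (tan h)\<^sup>2)"
  shows "(1 + cis (2 * t)) * cnj (Complex (cos (N - h)) (\<beta> * sin (N - h)))
    = Complex (cos (N + h)) (\<beta> * sin (N + h)) + Complex (cos (N - h)) (\<beta> * sin (N - h))"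
proof -
  have ct: "cos t > 0" using t by (intro cos_gt_zero) auto
  have tt: "tan t \<noteq> 0" using tan_gt_zero[of t] t by auto
  have s: "sin t = cos t * tan t" "sin h = cos h * tan h" using ct h by (auto simp: tan_def)
  have c2: "(cos t)\<^sup>2 * (1 + (tan t)\<^sup>2) = 1"
    using ct tan_sec[of t] by (simp add: field_simps)
  have bt: "\<beta> * tan t = tan h" using tt by (simp add: \<beta>_def)
  have diff: "cos (N - h) = cos h * (cos N + sin N * tan h)" "sin (N - h) = cos h * (sin N - cos N * tan h)"
    unfolding cos_diff sin_diff s(2) by (simp_all add: algebra_simps)
  have sums: "cos (N + h) + cos (N - h) = 2 * (cos h * cos N)" "sin (N + h) + sin (N - h) = 2 * (cos h * sin N)"
    by (simp_all add: cos_add cos_diff sin_add sin_diff)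
  note m = tilted_wave_matching[OF c2 bt tt root, of "cos h", folded diff s(1)]
  have w: "1 + cis (2 * t) = Complex (2 * cos t * cos t) (2 * cos t * sin t)"
    using cos_double_cos[of t] sin_double[of t] by (simp add: complex_eq_iff power2_eq_square)
  show ?thesis
    unfolding w
  proof (simp add: complex_eq_iff, intro conjI)
    show "2 * cos t * cos t * cos (N - h) + 2 * cos t * sin t * (\<beta> * sin (N - h)) = cos (N + h) + cos (N - h)"
      unfolding sums using m(1) by (simp add: algebra_simps)
    have "2 * cos t * sin t * cos (N - h) - 2 * cos t * cos t * (\<beta> * sin (N - h)) = \<beta> * (sin (N + h) + sin (N - h))"
      unfolding sums using m(2) by (simp add: algebra_simps)
    then show "2 * cos t * sin t * cos (N - h) - 2 * cos t * cos t * (\<beta> * sin (N - h)) = \<beta> * sin (N + h) + \<beta> * sin (N - h)"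
      by (simp add: algebra_simps)
  qed
qed

text \<open>
  Moving the top card to the bottom has phase \<open>w\<close>, the reverse move the conjugate phase, and the
  other two moves have phase 1.  The mode is \<open>w ^ k\<close> times a tilted wave at \<open>k\<close>, where \<open>k\<close> runs from
  1 to \<open>n\<close> and the top position is counted as \<open>n\<close>: the interval is cut between positions 0 and 1,
  which are the ones that the swap exchanges.  Since \<open>\<phi>\<close> has order \<open>n powr (- 3 / 2)\<close>, the whole wave
  differs from 1 by \<open>O(1/n)\<close>.
\<close>

lemma slow_mode_symmetrized_rudvalis:
  fixes \<phi> :: real
  assumes n: "n \<ge> 1000" and \<phi>: "0 < \<phi>" "\<phi>\<^sup>2 \<le> 40 / real n ^ 3"
    and root: "2 * sin (real n * (\<phi> / 2)) * tan (\<phi> / 2)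
      = cos (real n * (\<phi> / 2)) * ((tan (pi / real n))\<^sup>2 + (tan (\<phi> / 2))\<^sup>2)"
  shows "slow_mode n {..<4} (\<lambda>j. [up_position n, down_position n, swap_position, id] ! j) 400
    (of_real ((cos (\<phi> / 2))\<^sup>2))"
proof -
  have rn: "real n \<ge> 1000" using n by simp
  have n0: "n > 0" using n by simp
  have nphi2: "(real n * \<phi>)\<^sup>2 \<le> 40 / real n"
  proof -
    have "(real n * \<phi>)\<^sup>2 \<le> (real n)\<^sup>2 * (40 / real n ^ 3)"
      unfolding power_mult_distrib using \<phi>(2) by (intro mult_left_mono) auto
    also have "\<dots> = 40 / real n" using rn by (simp add: power2_eq_square power3_eq_cube)
    finally show ?thesis .
  qed
  have nphi: "real n * \<phi> \<le> 1 / 5"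
  proof (rule power2_le_imp_le)
    have "40 / real n \<le> (1 / 5)\<^sup>2" using rn by (simp add: field_simps power2_eq_square)
    then show "(real n * \<phi>)\<^sup>2 \<le> (1 / 5)\<^sup>2" using nphi2 by linarith
  qed simp
  have nphi2': "real n * \<phi>\<^sup>2 \<le> 40 / (real n)\<^sup>2"
  proof -
    have "real n * \<phi>\<^sup>2 \<le> real n * (40 / real n ^ 3)"
      using \<phi>(2) by (intro mult_left_mono) auto
    also have "\<dots> = 40 / (real n)\<^sup>2" using rn by (simp add: power2_eq_square power3_eq_cube)
    finally show ?thesis .
  qed
  have phi_small: "\<phi> \<le> 1 / 5"
    using nphi \<phi>(1) rn mult_right_mono[of 1 "real n" \<phi>] by linarith
  define \<beta> where "\<beta> = tan (\<phi> / 2) / tan (pi / real n)"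
  have pin: "0 < pi / real n" "pi / real n < pi / 2" using rn by (auto simp: field_simps)
  have cos_large: "1 / 2 \<le> cos y" if "\<bar>y\<bar> \<le> 1" for y :: real
  proof -
    have "cos (pi / 3) \<le> cos \<bar>y\<bar>" using that pi_gt3 by (intro cos_monotone_0_pi_le) auto
    then show ?thesis by (simp add: cos_60)
  qed
  have cos_h: "1 / 2 \<le> cos (\<phi> / 2)" using phi_small \<phi> by (intro cos_large) auto
  have \<beta>: "0 \<le> \<beta>" "\<beta> \<le> real n * \<phi>"
  proof -
    have tan_h: "tan (\<phi> / 2) \<le> \<phi>"
    proof -
      have "sin (\<phi> / 2) \<le> \<phi> / 2" using \<phi> by (intro sin_x_le_x) auto
      moreover have "\<phi> / 2 \<le> \<phi> * cos (\<phi> / 2)" using cos_h \<phi> mult_left_mono[of "1 / 2" "cos (\<phi> / 2)" \<phi>] by simp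
      ultimately show ?thesis using cos_h by (simp add: tan_def divide_le_eq)
    qed
    have tan_h0: "0 \<le> tan (\<phi> / 2)" using \<phi> phi_small pi_gt3 by (intro less_imp_le[OF tan_gt_zero]) auto
    have tan_t: "pi / real n \<le> tan (pi / real n)"
      using abs_tan_ge[of "pi / real n"] tan_gt_zero[of "pi / real n"] pin by simp
    show "0 \<le> \<beta>" unfolding \<beta>_def using tan_h0 tan_t pin by simp
    have "\<beta> \<le> \<phi> / (pi / real n)"
      unfolding \<beta>_def using tan_h tan_h0 tan_t pin by (intro frac_le) auto
    also have "\<dots> = real n * \<phi> / pi" by simp
    also have "\<dots> \<le> real n * \<phi>"
      using \<phi> pi_gt3 divide_left_mono[of 1 pi "real n * \<phi>"] by simp
    finally show "\<beta> \<le> real n * \<phi>" .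
  qed
  \<comment> \<open>The middle of \<open>1, \<dots>, n\<close> is \<open>(n + 1) / 2\<close>; \<open>G 0\<close> and \<open>G (n + 1)\<close> continue the wave beyond both ends.\<close>
  define G where "G k = tilted_wave \<phi> \<beta> (real k - (real n + 1) / 2)" for k :: nat
  define w where "w = unity_root n"
  define \<kappa> where "\<kappa> = (cos (\<phi> / 2))\<^sup>2"
  have w: "norm w = 1" "w ^ n = 1" "w * cnj w = 1" "norm (w - 1) \<le> 7 / real n"
    using n norm_unity_root_minus_1 by (auto simp: w_def cis_cnj cis_mult)
  have norm_w_mult: "norm (w ^ k * a) = norm a" "norm (cnj w * a) = norm a" for k a
    using w(1) by (simp_all add: norm_mult norm_power)
  have rec: "G k + G (k + 2) + 2 * G (k + 1) = 4 * of_real \<kappa> * G (k + 1)" for k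
    using tilted_wave_recurrence[of \<phi> \<beta> "real (k + 1) - (real n + 1) / 2"]
    unfolding G_def \<kappa>_def by (simp add: algebra_simps)
  \<comment> \<open>The reflection exchanges \<open>k\<close> and \<open>n + 1 - k\<close>.\<close>
  have reflect: "G 1 = cnj (G n)" "G 0 = cnj (G (n + 1))"
  proof -
    have "real 1 - (real n + 1) / 2 = - (real n - (real n + 1) / 2)"
      "real 0 - (real n + 1) / 2 = - (real (n + 1) - (real n + 1) / 2)"
      by (simp_all add: field_simps)
    then show "G 1 = cnj (G n)" "G 0 = cnj (G (n + 1))"
      unfolding G_def by (simp_all only: tilted_wave_minus)
  qed
  have cut: "(1 + w) * G 1 = G (n + 1) + G n"
  proof -
    have "\<phi> * (real n - (real n + 1) / 2) = real n * (\<phi> / 2) - \<phi> / 2"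
      "\<phi> * (real (n + 1) - (real n + 1) / 2) = real n * (\<phi> / 2) + \<phi> / 2"
      by (simp_all add: field_simps)
    then show ?thesis
      using tilted_wave_matching_at_cut[OF pin _ root, folded \<beta>_def] cos_h
      unfolding reflect by (simp add: G_def tilted_wave_def w_def)
  qed
  have cut': "(1 + w) * G n = w * G 0 + w * G 1"
  proof -
    have "cnj ((1 + w) * G 1) = cnj (G (n + 1) + G n)" unfolding cut ..
    then have "(1 + cnj w) * G n = G 0 + G 1" unfolding reflect by simp
    then have "w * ((1 + cnj w) * G n) = w * (G 0 + G 1)" by simp
    moreover have "w * ((1 + cnj w) * G n) = (w + w * cnj w) * G n" by (simp add: algebra_simps)
    ultimately show ?thesis unfolding w(3) by (simp add: algebra_simps)
  qed
  have G_bounds: "1 / 2 \<le> norm (G k)" "norm (G k) \<le> 2" if "k \<le> n" for k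
  proof -
    let ?y = "\<phi> * (real k - (real n + 1) / 2)"
    have "\<bar>real k - (real n + 1) / 2\<bar> \<le> real n" using that rn by (simp add: abs_le_iff field_simps)
    then have "\<bar>?y\<bar> \<le> real n * \<phi>" using \<phi> by (simp add: abs_mult mult.commute mult_right_mono)
    then have "1 / 2 \<le> cos ?y" using nphi by (intro cos_large) auto
    also have "\<dots> \<le> norm (G k)" using abs_Re_le_cmod[of "G k"] by (simp add: G_def tilted_wave_def)
    finally show "1 / 2 \<le> norm (G k)" .
    have "norm (G k) \<le> \<bar>cos ?y\<bar> + \<bar>\<beta> * sin ?y\<bar>"
      using cmod_le[of "G k"] by (simp add: G_def tilted_wave_def)
    also have "\<dots> \<le> 1 + \<beta> * 1"
      using mult_left_mono[OF abs_sin_le_one \<beta>(1), of ?y] \<beta>(1)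
      by (intro add_mono) (simp_all add: abs_mult)
    also have "\<dots> \<le> 2" using \<beta>(2) nphi by simp
    finally show "norm (G k) \<le> 2" .
  qed
  have G_step: "norm (G (k + 1) - G k) \<le> 80 / (real n)\<^sup>2" if "k \<le> n" for k
  proof -
    have "\<bar>real k - (real n + 1) / 2 + 1 / 2\<bar> \<le> real n" using that by (simp add: abs_le_iff field_simps)
    from tilted_wave_step[OF this _ \<beta>(1), of \<phi>] \<phi>
    have "norm (G (k + 1) - G k) \<le> real n * \<phi>\<^sup>2 + \<beta> * \<phi>"
      by (simp add: G_def algebra_simps)
    also have "\<beta> * \<phi> \<le> real n * \<phi>\<^sup>2"
      using \<beta>(2) \<phi> mult_right_mono[of \<beta> "real n * \<phi>" \<phi>] by (simp add: power2_eq_square)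
    finally show ?thesis using nphi2' by simp
  qed
  \<comment> \<open>The two ends of the interval are neighbours in the deck, and the wave jumps between them.\<close>
  have G_jump: "norm (G n - G 1) \<le> 40 / real n"
  proof -
    have "norm (G n - G 1) = \<bar>2 * Im (G n)\<bar>"
      unfolding reflect complex_diff_cnj by (simp add: norm_mult)
    also have "\<dots> = 2 * \<beta> * \<bar>sin (\<phi> * (real n - (real n + 1) / 2))\<bar>"
      using \<beta>(1) by (simp add: G_def tilted_wave_def abs_mult)
    also have "\<dots> \<le> 2 * (real n * \<phi>) * (real n * \<phi> / 2)"
    proof (intro mult_mono)
      have "\<bar>sin (\<phi> * (real n - (real n + 1) / 2))\<bar> \<le> \<bar>\<phi> * (real n - (real n + 1) / 2)\<bar>"
        by (rule abs_sin_x_le_abs_x)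
      also have "\<dots> = \<phi> * ((real n - 1) / 2)" using \<phi> rn by (simp add: abs_mult field_simps)
      also have "\<dots> \<le> real n * \<phi> / 2" using \<phi> by (simp add: field_simps)
      finally show "\<bar>sin (\<phi> * (real n - (real n + 1) / 2))\<bar> \<le> real n * \<phi> / 2" .
    qed (use \<beta> \<phi> in auto)
    also have "\<dots> = (real n * \<phi>)\<^sup>2" by (simp add: power2_eq_square)
    finally show ?thesis using nphi2 by linarith
  qed
  have \<kappa>: "0 \<le> \<kappa>" "\<kappa> \<le> 1" "1 - \<kappa> \<le> 10 / (real n)\<^sup>2"
  proof -
    show "0 \<le> \<kappa>" "\<kappa> \<le> 1" by (auto simp: \<kappa>_def abs_square_le_1)
    have "1 - \<kappa> = (sin (\<phi> / 2))\<^sup>2" by (simp add: \<kappa>_def cos_squared_eq)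
    also have "\<dots> \<le> (\<phi> / 2)\<^sup>2"
      using abs_sin_x_le_abs_x[of "\<phi> / 2"] by (rule abs_le_square_iff[THEN iffD1])
    also have "\<dots> \<le> (real n * \<phi>\<^sup>2) / 4"
      using rn mult_right_mono[of 1 "real n" "\<phi>\<^sup>2"] by (simp add: power_divide)
    finally show "1 - \<kappa> \<le> 10 / (real n)\<^sup>2" using nphi2' by simp
  qed
  have damp: "norm ((1 - of_real \<kappa>) * G k) \<le> 20 / (real n)\<^sup>2" if "k \<le> n" for k
  proof -
    have "norm ((1 - of_real \<kappa>) * G k) = (1 - \<kappa>) * norm (G k)"
      using \<kappa> norm_of_real[where ?'a = complex, of "1 - \<kappa>"] by (simp add: norm_mult)
    also have "\<dots> \<le> 10 / (real n)\<^sup>2 * 2" using \<kappa> G_bounds[OF that] by (intro mult_mono) auto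
    finally show ?thesis by simp
  qed
  have near: "norm (G k - of_real \<kappa> * G l) \<le> norm (G k - G l) + 20 / (real n)\<^sup>2" if "l \<le> n" for k l
  proof -
    have eq: "G k - of_real \<kappa> * G l = (G k - G l) + (1 - of_real \<kappa>) * G l" by (simp add: algebra_simps)
    show ?thesis unfolding eq using norm_triangle_ineq[of "G k - G l" "(1 - of_real \<kappa>) * G l"] damp[OF that] by simp
  qed
  have bulk_up: "norm (G k - of_real \<kappa> * G (k + 1)) \<le> 100 / (real n)\<^sup>2" if "k < n" for k
    using near[of "k + 1" k] G_step[of k] that by (simp add: norm_minus_commute)
  have bulk_down: "norm (G (k + 1) - of_real \<kappa> * G k) \<le> 100 / (real n)\<^sup>2" if "k \<le> n" for k
    using near[of k "k + 1"] G_step[of k] that by simp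
  have small: "100 / (real n)\<^sup>2 \<le> 100 / real n" "20 / (real n)\<^sup>2 \<le> 10 / real n" "10 / real n \<le> 100 / real n"
    using rn by (auto simp: field_simps power2_eq_square)
  have "40 / real n + 10 / real n = 50 / real n" by simp
  then have cut_up: "norm (G n - of_real \<kappa> * G 1) \<le> 50 / real n"
    and cut_down: "norm (G 1 - of_real \<kappa> * G n) \<le> 50 / real n"
    using near[of 1 n] near[of n 1] norm_minus_commute[of "G 1" "G n"] G_jump small(2) n by linarith+
  have twist: "norm ((w - 1) * G 1) \<le> 14 / real n" "norm (of_real \<kappa> * ((w - 1) * G 1)) \<le> 14 / real n"
  proof -
    have "norm (w - 1) * norm (G 1) \<le> 7 / real n * 2"
      using w(4) G_bounds[of 1] n by (intro mult_mono) auto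
    then show *: "norm ((w - 1) * G 1) \<le> 14 / real n" by (simp add: norm_mult)
    have "norm (of_real \<kappa> * ((w - 1) * G 1)) \<le> norm ((w - 1) * G 1)"
      using \<kappa> mult_left_le_one_le[of "norm ((w - 1) * G 1)" \<kappa>] by (simp add: norm_mult)
    then show "norm (of_real \<kappa> * ((w - 1) * G 1)) \<le> 14 / real n" using * by linarith
  qed
  \<comment> \<open>The top position 0 is counted as \<open>n\<close>.\<close>
  define f where "f i = (let k = if i = 0 then n else i in w ^ k * G k)" for i
  have f_0: "f 0 = G n" and f_pos: "0 < i \<Longrightarrow> f i = w ^ i * G i" for i
    using w by (simp_all add: f_def)
  have up: "w * f (up_position n i) = (if i = 0 then G (n - 1) else if i = 1 then w * G n else w ^ i * G (i - 1))" for i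
  proof -
    have "w * w ^ (n - 1) = 1" using w(2) n0 by (simp flip: power_Suc)
    moreover have "w * w ^ (i - 1) = w ^ i" if "2 \<le> i" using that by (simp flip: power_Suc)
    ultimately show ?thesis
      using n by (auto simp: up_position_def f_0 f_pos mult.assoc[symmetric])
  qed
  have down: "cnj w * f (down_position n i) = (if i = 0 then G 1 else w ^ i * G (i + 1))" if "i < n" for i
  proof -
    have c: "cnj w * (w * a) = a" for a using w(3) by (metis mult.assoc mult.commute mult_1)
    have "cnj w = w ^ (n - 1)"
    proof -
      have "cnj w * (w * w ^ (n - 1)) = w ^ (n - 1)" by (rule c)
      then show ?thesis using w(2) n0 by (simp flip: power_Suc)
    qed
    then show ?thesis
      using that n c by (auto simp: down_position_def f_0 f_pos mult.assoc)
  qed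
  have swap: "f (swap_position i) = (if i = 0 then w * G 1 else if i = 1 then G n else f i)" for i
    by (simp add: swap_position_def f_0 f_pos)
  let ?\<tau> = "\<lambda>j. [w, cnj w, 1, 1] ! j" and ?\<sigma> = "\<lambda>j. [up_position n, down_position n, swap_position, id] ! j"
  have four: "j = 0 \<or> j = 1 \<or> j = 2 \<or> j = 3" if "j \<in> {..<4}" for j :: nat using that by auto
  have term_bulk: "norm (?\<tau> j * f (?\<sigma> j i) - of_real \<kappa> * f i) \<le> 100 / (real n)\<^sup>2"
    if j: "j \<in> {..<4}" and i: "2 \<le> i" "i < n" for i j
  proof -
    have "w * f (up_position n i) - of_real \<kappa> * f i = w ^ i * (G (i - 1) - of_real \<kappa> * G i)"
      using i by (simp add: up f_pos algebra_simps)
    then have 1: "norm (w * f (up_position n i) - of_real \<kappa> * f i) \<le> 100 / (real n)\<^sup>2"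
      using bulk_up[of "i - 1"] i by (simp only: norm_w_mult, simp?)
    have "cnj w * f (down_position n i) - of_real \<kappa> * f i = w ^ i * (G (i + 1) - of_real \<kappa> * G i)"
      using i by (simp add: down f_pos algebra_simps)
    then have 2: "norm (cnj w * f (down_position n i) - of_real \<kappa> * f i) \<le> 100 / (real n)\<^sup>2"
      using bulk_down[of i] i by (simp only: norm_w_mult, simp?)
    have "f i - of_real \<kappa> * f i = w ^ i * ((1 - of_real \<kappa>) * G i)"
      using i by (simp add: f_pos algebra_simps)
    then have 3: "norm (f i - of_real \<kappa> * f i) \<le> 100 / (real n)\<^sup>2"
      using damp[of i] i by (simp only: norm_w_mult) (rule order_trans[OF _ divide_right_mono[of 20 100]], simp_all)
    have "f (swap_position i) = f i" using i by (simp add: swap_position_def)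
    then show ?thesis using four[OF j] 1 2 3 by (auto simp: numeral_2_eq_2 numeral_3_eq_3)
  qed
  have term_edge: "norm (?\<tau> j * f (?\<sigma> j i) - of_real \<kappa> * f i) \<le> 100 / real n"
    if j: "j \<in> {..<4}" and i: "i < n" for i j
  proof -
    have edge: "14 / real n + 50 / real n \<le> 100 / real n" using rn by (simp add: field_simps)
    consider "2 \<le> i" | "i = 0" | "i = 1" by linarith
    then show ?thesis
    proof cases
      case 1
      then show ?thesis using term_bulk[OF j 1 i] small by linarith
    next
      case 2
      have a: "norm (w * f (up_position n 0) - of_real \<kappa> * f 0) \<le> 100 / real n"
        using bulk_up[of "n - 1"] n small by (simp add: up f_0)
      have b: "norm (cnj w * f (down_position n 0) - of_real \<kappa> * f 0) \<le> 100 / real n"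
        using cut_down n by (simp add: down f_0 divide_simps)
      have eq: "f (swap_position 0) - of_real \<kappa> * f 0 = (w - 1) * G 1 + (G 1 - of_real \<kappa> * G n)"
        by (simp add: swap f_0 algebra_simps)
      have c: "norm (f (swap_position 0) - of_real \<kappa> * f 0) \<le> 100 / real n"
        unfolding eq using norm_triangle_ineq[of "(w - 1) * G 1" "G 1 - of_real \<kappa> * G n"] twist(1) cut_down edge
        by linarith
      have "f 0 - of_real \<kappa> * f 0 = (1 - of_real \<kappa>) * G n" by (simp add: f_0 algebra_simps)
      then have d: "norm (f 0 - of_real \<kappa> * f 0) \<le> 100 / real n"
        using damp[of n] small by simp
      show ?thesis using four[OF j] a b c d 2 by (auto simp: numeral_2_eq_2 numeral_3_eq_3)
    next
      case 3
      have "w * f (up_position n 1) - of_real \<kappa> * f 1 = w ^ 1 * (G n - of_real \<kappa> * G 1)"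
        by (simp add: up f_pos algebra_simps)
      then have a: "norm (w * f (up_position n 1) - of_real \<kappa> * f 1) \<le> 100 / real n"
        using cut_up n by (simp only: norm_w_mult, simp add: divide_simps)
      have "cnj w * f (down_position n 1) - of_real \<kappa> * f 1 = w ^ 1 * (G (1 + 1) - of_real \<kappa> * G 1)"
        using n by (simp add: down f_pos algebra_simps)
      then have b: "norm (cnj w * f (down_position n 1) - of_real \<kappa> * f 1) \<le> 100 / real n"
        using bulk_down[of 1] n small by (simp only: norm_w_mult, simp?)
      have eq: "f (swap_position 1) - of_real \<kappa> * f 1 = (G n - of_real \<kappa> * G 1) - of_real \<kappa> * ((w - 1) * G 1)"
        by (simp add: swap f_pos algebra_simps)
      have c: "norm (f (swap_position 1) - of_real \<kappa> * f 1) \<le> 100 / real n"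
        unfolding eq using norm_triangle_ineq4[of "G n - of_real \<kappa> * G 1" "of_real \<kappa> * ((w - 1) * G 1)"] twist(2) cut_up edge
        by linarith
      have "f 1 - of_real \<kappa> * f 1 = w ^ 1 * ((1 - of_real \<kappa>) * G 1)" by (simp add: f_pos algebra_simps)
      then have d: "norm (f 1 - of_real \<kappa> * f 1) \<le> 100 / real n"
        using damp[of 1] n small by (simp only: norm_w_mult, simp?)
      show ?thesis using four[OF j] a b c d 3 by (auto simp: numeral_2_eq_2 numeral_3_eq_3)
    qed
  qed
  have eigen: "w * f (up_position n i) + cnj w * f (down_position n i) + f (swap_position i) + f i
      = 4 * of_real \<kappa> * f i" if i: "i < n" for i
  proof -
    consider "2 \<le> i" | "i = 0" | "i = 1" by linarith
    then show ?thesis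
    proof cases
      case 1
      have "w ^ i * (G (i - 1) + G (i + 1) + 2 * G i) = w ^ i * (4 * of_real \<kappa> * G i)"
        using rec[of "i - 1"] 1 by (simp add: numeral_2_eq_2)
      then show ?thesis using 1 i by (simp add: up down swap f_pos algebra_simps)
    next
      case 2
      have "w * f (up_position n i) + cnj w * f (down_position n i) + f (swap_position i) + f i
          = G (n - 1) + (1 + w) * G 1 + G n"
        using 2 n by (simp add: up down swap f_0 algebra_simps)
      also have "\<dots> = G (n - 1) + G (n + 1) + 2 * G n" unfolding cut by simp
      also have "\<dots> = 4 * of_real \<kappa> * f i"
        using rec[of "n - 1"] n 2 by (simp add: numeral_2_eq_2 f_0)
      finally show ?thesis .
    next
      case 3
      have "w * f (up_position n i) + cnj w * f (down_position n i) + f (swap_position i) + f i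
          = (1 + w) * G n + w * (G 2 + G 1)"
        using 3 n by (simp add: up down swap f_pos numeral_2_eq_2 algebra_simps)
      also have "\<dots> = w * (G 0 + G 2 + 2 * G 1)" unfolding cut' by (simp add: algebra_simps)
      also have "\<dots> = w * (4 * of_real \<kappa> * G 1)"
        using rec[of 0] by (simp add: numeral_2_eq_2)
      also have "\<dots> = 4 * of_real \<kappa> * f i" using 3 by (simp add: f_pos)
      finally show ?thesis .
    qed
  qed
  show ?thesis
    unfolding slow_mode_def \<kappa>_def[symmetric]
  proof (rule exI[of _ ?\<tau>], rule exI[of _ f], intro conjI allI impI ballI)
    fix i assume i: "i < n"
    show "(\<Sum>j<4. ?\<tau> j * f (?\<sigma> j i)) = of_nat (card {..<4::nat}) * of_real \<kappa> * f i"
      using eigen[OF i] by (simp add: eval_nat_numeral)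
    show "1 / 2 \<le> norm (f i)" "norm (f i) \<le> 2"
      using G_bounds[of "if i = 0 then n else i"] i by (auto simp: f_def Let_def norm_w_mult)
  next
    fix j :: nat assume j: "j \<in> {..<4}"
    show "norm (?\<tau> j) = 1" using four[OF j] w(1) by (auto simp: numeral_2_eq_2 numeral_3_eq_3)
    have "(\<Sum>i<n. norm (?\<tau> j * f (?\<sigma> j i) - of_real \<kappa> * f i)) \<le> (3 * 100 + 100) / real n"
      using n term_bulk[OF j] term_edge[OF j] by (intro sum_with_three_exceptions) auto
    then show "(\<Sum>i<n. norm (?\<tau> j * f (?\<sigma> j i) - of_real \<kappa> * f i)) \<le> 400 / real n" by simp
  qed
qed

lemma sin_ge_half:
  fixes h :: real
  assumes "0 \<le> h" "h \<le> 1"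
  shows "h / 2 \<le> sin h"
proof -
  have "\<bar>sin h - h\<bar> \<le> h ^ 3 / 6"
    using Maclaurin_sin_bound[of h 3] assms
    by (simp add: numeral_3_eq_3 sin_coeff_def fact_numeral lessThan_Suc)
  moreover have "h ^ 3 \<le> h" using power_decreasing[of 1 3 h] assms by simp
  ultimately show ?thesis by linarith
qed

text \<open>
  At \<open>\<phi> = r * n powr (- 3 / 2)\<close> the difference of the two sides of the matching condition,
  multiplied by \<open>n\<^sup>2\<close>, tends to \<open>r\<^sup>2 / 2 - pi\<^sup>2\<close>.  It changes sign between \<open>r = pi\<close>, a
  convenient value below the critical one \<open>sqrt 2 * pi\<close>, and \<open>r = s\<close>, slightly above it.
\<close>

lemma symmetrized_rudvalis_frequency:
  assumes \<eta>: "0 < \<eta>" "\<eta> < 1"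
  shows "\<forall>\<^sub>F n in sequentially. \<exists>\<phi> > 0. pi\<^sup>2 / real n ^ 3 \<le> \<phi>\<^sup>2 \<and> \<phi>\<^sup>2 \<le> 2 * pi\<^sup>2 * (1 + \<eta>) / real n ^ 3 \<and>
    2 * sin (real n * (\<phi> / 2)) * tan (\<phi> / 2)
      = cos (real n * (\<phi> / 2)) * ((tan (pi / real n))\<^sup>2 + (tan (\<phi> / 2))\<^sup>2)"
proof -
  define s where "s = sqrt (2 * pi\<^sup>2 * (1 + \<eta>))"
  have s2: "s\<^sup>2 = 2 * pi\<^sup>2 * (1 + \<eta>)" using \<eta> by (simp add: s_def)
  have s: "pi < s"
  proof (rule power2_less_imp_less)
    have "1 * pi\<^sup>2 < (2 * (1 + \<eta>)) * pi\<^sup>2" using \<eta> by (intro mult_strict_right_mono) auto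
    then show "pi\<^sup>2 < s\<^sup>2" unfolding s2 by (simp add: mult_ac)
    show "0 \<le> s" using \<eta> by (simp add: s_def)
  qed
  define D where "D n \<phi> = 2 * sin (real n * (\<phi> / 2)) * tan (\<phi> / 2)
      - cos (real n * (\<phi> / 2)) * ((tan (pi / real n))\<^sup>2 + (tan (\<phi> / 2))\<^sup>2)" for n :: nat and \<phi> :: real
  define \<psi> where "\<psi> n = 1 / (real n * sqrt (real n))" for n
  have lim: "(\<lambda>n. real n ^ 2 * D n (r * \<psi> n)) \<longlonglongrightarrow> r\<^sup>2 / 2 - pi\<^sup>2" if "r > 0" for r
    unfolding D_def \<psi>_def using that by (real_asymp simp: power2_eq_square)
  have "\<forall>\<^sub>F n in sequentially. real n ^ 2 * D n (pi * \<psi> n) < 0"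
    by (rule order_tendstoD(2)[OF lim]) simp_all
  moreover have "\<forall>\<^sub>F n in sequentially. real n ^ 2 * D n (s * \<psi> n) > 0"
    by (rule order_tendstoD(1)[OF lim]) (use \<eta> order.strict_trans[OF pi_gt_zero s] in \<open>simp_all add: s2\<close>)
  moreover have "(\<lambda>n. s * \<psi> n) \<longlonglongrightarrow> 0" unfolding \<psi>_def by real_asymp
  then have "\<forall>\<^sub>F n in sequentially. s * \<psi> n < 1" by (rule order_tendstoD) simp
  ultimately show ?thesis
    using eventually_gt_at_top[of 0]
  proof eventually_elim
    case (elim n)
    have \<psi>: "0 < \<psi> n" "(\<psi> n)\<^sup>2 = 1 / real n ^ 3"
      using elim(4) by (auto simp: \<psi>_def power_divide power_mult_distrib power2_eq_square power3_eq_cube)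
    have sign: "D n (pi * \<psi> n) \<le> 0" "0 \<le> D n (s * \<psi> n)"
      using elim by (auto simp: mult_less_0_iff zero_less_mult_iff)
    have "cos (x / 2) \<noteq> 0" if x: "x \<in> {pi * \<psi> n..s * \<psi> n}" for x
    proof -
      have "0 < pi * \<psi> n" using \<psi>(1) by simp
      then have "0 < x" "x < 1" using x elim(3) unfolding atLeastAtMost_iff by linarith+
      then have "cos (x / 2) > 0" using pi_gt3 by (intro cos_gt_zero) auto
      then show "cos (x / 2) \<noteq> 0" by simp
    qed
    then have "continuous_on {pi * \<psi> n..s * \<psi> n} (D n)"
      unfolding D_def by (intro continuous_intros) auto
    then obtain \<phi> where \<phi>: "pi * \<psi> n \<le> \<phi>" "\<phi> \<le> s * \<psi> n" "D n \<phi> = 0"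
      using IVT'[of "D n" "pi * \<psi> n" 0 "s * \<psi> n"] sign s \<psi>(1) by auto
    have pos: "0 < pi * \<psi> n" using \<psi>(1) by simp
    have "(pi * \<psi> n)\<^sup>2 \<le> \<phi>\<^sup>2" "\<phi>\<^sup>2 \<le> (s * \<psi> n)\<^sup>2"
      using \<phi> pos by (auto intro!: power_mono)
    then have "pi\<^sup>2 / real n ^ 3 \<le> \<phi>\<^sup>2" "\<phi>\<^sup>2 \<le> 2 * pi\<^sup>2 * (1 + \<eta>) / real n ^ 3"
      unfolding power_mult_distrib s2 \<psi>(2) by simp_all
    then show ?case
      using \<phi>(1,3) pos unfolding D_def by (intro exI[of _ \<phi>]) auto
  qed
qed

theorem symmetrized_rudvalis_lower_bound:
  assumes "\<epsilon> > 0"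
  shows "\<exists>\<delta> :: nat \<Rightarrow> real. \<delta> \<longlonglongrightarrow> 0 \<and> (\<forall>\<^sub>F n in sequentially. \<forall>start \<in> permutations_of_set {..<n}.
      tv_dist (law_after symmetrized_rudvalis start (nat \<lfloor>(1 - \<delta> n) / (2 * (pi\<^sup>2 / 2)) * real n ^ 3 * ln (real n)\<rfloor>))
        (uniform_deck n) \<ge> 1 - \<epsilon>)"
  unfolding symmetrized_rudvalis_eq_random_move
proof (rule mixing_lower_bound[where c = "1 / 2" and C = 400
      and \<sigma> = "\<lambda>n j. [up_position n, down_position n, swap_position, id] ! j"])
  show "\<forall>\<^sub>F n in sequentially. \<forall>j\<in>{..<4}. moves_positions n ([rotate1, bottom_to_top, swap_top, id] ! j)
      ([up_position n, down_position n, swap_position, id] ! j)"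
    using eventually_ge_at_top[of 2]
  proof eventually_elim
    case (elim n)
    have "j = 0 \<or> j = 1 \<or> j = 2 \<or> j = 3" if "j \<in> {..<4}" for j :: nat using that by auto
    then show ?case
      using elim moves_positions_rotate1[of n] moves_positions_bottom_to_top[of n]
        moves_positions_swap_top[of n] moves_positions_id[of n]
      by (fastforce simp: numeral_2_eq_2 numeral_3_eq_3)
  qed
  fix \<eta> :: real assume \<eta>: "0 < \<eta>" "\<eta> < 1"
  show "\<forall>\<^sub>F n in sequentially. \<exists>\<kappa>. slow_mode n {..<4} (\<lambda>j. [up_position n, down_position n, swap_position, id] ! j) 400 \<kappa> \<and>
        1 / 2 / real n ^ 3 \<le> 1 - (norm \<kappa>)\<^sup>2 \<and> 1 - (norm \<kappa>)\<^sup>2 \<le> 2 * (pi\<^sup>2 / 2) * (1 + \<eta>) / real n ^ 3"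
    using symmetrized_rudvalis_frequency[OF \<eta>] eventually_ge_at_top[of 1000]
  proof eventually_elim
    case (elim n)
    then obtain \<phi> where \<phi>: "\<phi> > 0" "pi\<^sup>2 / real n ^ 3 \<le> \<phi>\<^sup>2" "\<phi>\<^sup>2 \<le> 2 * pi\<^sup>2 * (1 + \<eta>) / real n ^ 3"
      and root: "2 * sin (real n * (\<phi> / 2)) * tan (\<phi> / 2)
        = cos (real n * (\<phi> / 2)) * ((tan (pi / real n))\<^sup>2 + (tan (\<phi> / 2))\<^sup>2)"
      by blast
    define \<kappa> where "\<kappa> = (cos (\<phi> / 2))\<^sup>2"
    have n: "real n \<ge> 1000" using elim by simp
    have "2 * pi\<^sup>2 * (1 + \<eta>) \<le> 2 * 10 * 2" using \<eta> pi_square_bounds by (intro mult_mono) auto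
    then have "2 * pi\<^sup>2 * (1 + \<eta>) / real n ^ 3 \<le> 40 / real n ^ 3" by (intro divide_right_mono) auto
    then have \<phi>40: "\<phi>\<^sup>2 \<le> 40 / real n ^ 3" using \<phi>(3) by linarith
    have "40 / real n ^ 3 \<le> 40 / 1000 ^ 3" using n by (intro divide_left_mono power_mono) auto
    then have "\<phi>\<^sup>2 \<le> 1\<^sup>2" using \<phi>40 by simp
    then have \<phi>1: "\<phi> \<le> 1" by (rule power2_le_imp_le) simp
    have sin2: "(sin (\<phi> / 2))\<^sup>2 = 1 - \<kappa>" by (simp add: \<kappa>_def sin_squared_eq)
    have \<kappa>: "0 \<le> \<kappa>" "\<kappa> \<le> 1" by (auto simp: \<kappa>_def abs_square_le_1)
    have gap: "1 - (norm (of_real \<kappa> :: complex))\<^sup>2 = (1 - \<kappa>) * (1 + \<kappa>)"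
      by (simp add: power2_eq_square algebra_simps)
    have "1 / 2 / real n ^ 3 \<le> (pi\<^sup>2 / real n ^ 3) / 16"
      using pi_square_bounds n by (simp add: divide_simps)
    also have "\<dots> \<le> (\<phi> / 2 / 2)\<^sup>2" using \<phi>(2) by (simp add: power_divide)
    also have "\<dots> \<le> (sin (\<phi> / 2))\<^sup>2" using sin_ge_half[of "\<phi> / 2"] \<phi>(1) \<phi>1 by (intro power_mono) auto
    also have "\<dots> \<le> (1 - \<kappa>) * (1 + \<kappa>)"
      unfolding sin2 using \<kappa> mult_left_mono[of 1 "1 + \<kappa>" "1 - \<kappa>"] by simp
    finally have lower: "1 / 2 / real n ^ 3 \<le> 1 - (norm (of_real \<kappa> :: complex))\<^sup>2" unfolding gap .
    have "(1 - \<kappa>) * (1 + \<kappa>) \<le> (sin (\<phi> / 2))\<^sup>2 * 2"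
      unfolding sin2 using \<kappa> by (intro mult_left_mono) auto
    also have "\<dots> \<le> (\<phi> / 2)\<^sup>2 * 2"
      using abs_sin_x_le_abs_x[of "\<phi> / 2"] by (intro mult_right_mono abs_le_square_iff[THEN iffD1]) auto
    also have "\<dots> \<le> 2 * (pi\<^sup>2 / 2) * (1 + \<eta>) / real n ^ 3" using \<phi>(3) by (simp add: power_divide mult_ac)
    finally have upper: "1 - (norm (of_real \<kappa> :: complex))\<^sup>2 \<le> 2 * (pi\<^sup>2 / 2) * (1 + \<eta>) / real n ^ 3" unfolding gap .
    show ?case
      using slow_mode_symmetrized_rudvalis[OF elim(2) \<phi>(1) \<phi>40 root] lower upper unfolding \<kappa>_def by blast
  qed
qed (use assms in \<open>auto simp: lessThan_empty_iff\<close>)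

section \<open>The three lower bounds\<close>

theorem theorem1:
  fixes \<epsilon> :: real
  assumes "\<epsilon> > 0"
  shows "(\<exists>\<delta> :: nat \<Rightarrow> real. \<delta> \<longlonglongrightarrow> 0 \<and>
      (\<forall>\<^sub>F n in sequentially. \<forall>start \<in> permutations_of_set {..<n}.
        tv_dist
          (law_after rudvalis start (nat \<lfloor>(1 - \<delta> n) / (8 * pi\<^sup>2) * real n ^ 3 * ln (real n)\<rfloor>))
          (uniform_deck n) \<ge> 1 - \<epsilon>)) \<and>
    (\<exists>\<delta> :: nat \<Rightarrow> real. \<delta> \<longlonglongrightarrow> 0 \<and>
      (\<forall>\<^sub>F n in sequentially. \<forall>start \<in> permutations_of_set {..<n}.
        tv_dist
          (law_after shift_or_swap start (nat \<lfloor>(1 - \<delta> n) / (2 * pi\<^sup>2) * real n ^ 3 * ln (real n)\<rfloor>))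
          (uniform_deck n) \<ge> 1 - \<epsilon>)) \<and>
    (\<exists>\<delta> :: nat \<Rightarrow> real. \<delta> \<longlonglongrightarrow> 0 \<and>
      (\<forall>\<^sub>F n in sequentially. \<forall>start \<in> permutations_of_set {..<n}.
        tv_dist
          (law_after symmetrized_rudvalis start (nat \<lfloor>(1 - \<delta> n) / (pi\<^sup>2) * real n ^ 3 * ln (real n)\<rfloor>))
          (uniform_deck n) \<ge> 1 - \<epsilon>))"
proof -
  have "2 * (4 * pi\<^sup>2) = 8 * pi\<^sup>2" "2 * (pi\<^sup>2 / 2) = pi\<^sup>2" by simp_all
  then show ?thesis
    using rudvalis_lower_bound[OF assms] shift_or_swap_lower_bound[OF assms]
      symmetrized_rudvalis_lower_bound[OF assms]
    by (intro conjI) simp_all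
qed

end
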